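(* Let $q>2$ be a prime power and let $s=2k\geq 4$ be an even number. Then the weight distribution of $\mathcal{C}_{C_s}$ can be expressed as follows: $$A_{\sum_{i=0}^{r-1}(-1)^i(q-1)^{s-i}}(\mathcal{C}_{C_s})=\binom{s}{r}(q-1)^r\quad\text{for every } r\in\{1,2,\dots,s-1\},$$ $$A_{(q-1)^s-q^{k-2}[(q-1)^3+(q-1)^2(q-2)]-\frac{(q-1)^s-(q-1)(q^{k-2}-1)-q^{k-2}(q-1)^4}{q}}(\mathcal{C}_{C_s})=(q-1)^{s-1},$$ $$A_{(q-1)^s-q^{k-2}(q-1)^2(q-3)-\frac{(q-1)^s-(q-1)(q^{k-2}-1)-q^{k-2}(q-1)^4}{q}}(\mathcal{C}_{C_s})=(q-1)^s-(q-1)^{s-1},$$ and $A_j(\mathcal{C}_{C_s})=0$ for the remaining values of $j$. Consequently, the minimum distance of $\mathcal{C}_{C_s}$ is $$\delta(\mathcal{C}_{C_s})=\begin{cases}(q-1)^s-q^{k-2}\left[(q-1)^3+(q-1)^2(q-2)\right]-\dfrac{(q-1)^s-(q-1)(q^{k-2}-1)}{q}+q^{k-3}(q-1)^4 & \text{if } q^k(q-2)+1\geq (q-1)^{2k-2},\\[2mm] (q-1)^{s-1}(q-2) & \text{otherwise.}\end{cases}$$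
   Context: $K=\mathbb{F}_q$ is the finite field with $q$ elements and $\mathbb{F}_q^*=\mathbb{F}_q\setminus\{0\}$. $C_s$ is the cycle of length $s$, with vertices $t_1,\dots,t_s$ and edges $\{t_i,t_{i+1}\}$ ($1\le i\le s-1$) and $\{t_1,t_s\}$. For a finite simple graph $G$ on $\{t_1,\dots,t_s\}$ with edge set $E$, the vertices are also regarded as variables and $KE(G)=\mathrm{span}_K\{t_it_j : \{t_i,t_j\}\in E\}\subseteq K[t_1,\dots,t_s]$. Put $T=(\mathbb{F}_q^* )^s=\{P_1,\dots,P_{|T|}\}$, $|T|=(q-1)^s$. The edge code of $G$ is $\mathcal{C}_G=\{(f(P_1),\dots,f(P_{|T|})): f\in KE(G)\}\subseteq K^{|T|}$. The Hamming weight of a codeword is its number of non-zero coordinates; $A_i(\mathcal{C}_G)$ is the number of codewords of Hamming weight $i$ ($1\le i\le |T|$), the weight distribution is $(A_1(\mathcal{C}_G),\dots,A_{|T|}(\mathcal{C}_G))$, and the minimum distance $\delta(\mathcal{C}_G)$ is the smallest $i$ with $A_i(\mathcal{C}_G)\neq 0$.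
   Formalization: For q=3, s=4 the weight for r=1 and the weight in the third formula are both 16, so the two printed values of A_16 (8 each) are false; there the formal statement gives A_16 = 8+8 = 16, the sum of the two values. All other cases are as printed. *)

theory Defs
  imports Complex_Main "HOL-Library.Poly_Mapping" "HOL-Library.FuncSet" "HOL-Library.Cardinality"
begin

section \<open>Polynomials\<close>

text \<open>A polynomial in the variables \<open>t\<^sub>1, t\<^sub>2, \<dots>\<close> is a finitely supported map from monomials to
  coefficients, and a monomial is a finitely supported map from variable indices to exponents.\<close>

type_synonym 'a mpoly = "(nat \<Rightarrow>\<^sub>0 nat) \<Rightarrow>\<^sub>0 'a"

definition var :: "nat \<Rightarrow> 'a::comm_semiring_1 mpoly" where
  "var i = Poly_Mapping.single (Poly_Mapping.single i 1) 1"

definition smult_mpoly :: "'a::comm_semiring_1 \<Rightarrow> 'a mpoly \<Rightarrow> 'a mpoly" where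
  "smult_mpoly c f = Poly_Mapping.single 0 c * f"

definition eval_mpoly :: "(nat \<Rightarrow> 'a::comm_semiring_1) \<Rightarrow> 'a mpoly \<Rightarrow> 'a" where
  "eval_mpoly P f = (\<Sum>m\<in>Poly_Mapping.keys f. Poly_Mapping.lookup f m *
     (\<Prod>i\<in>Poly_Mapping.keys m. P i ^ Poly_Mapping.lookup m i))"

global_interpretation mpoly: vector_space "smult_mpoly :: 'a::field \<Rightarrow> 'a mpoly \<Rightarrow> 'a mpoly"
  by unfold_locales
    (simp_all add: smult_mpoly_def algebra_simps single_add mult_single flip: mult.assoc)


section \<open>Codes\<close>

text \<open>A word over a finite set \<open>I\<close> of coordinates is a function extensional on \<open>I\<close>.\<close>

definition hamming_weight :: "'i set \<Rightarrow> ('i \<Rightarrow> 'a::zero) \<Rightarrow> nat" where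
  "hamming_weight I c = card {p \<in> I. c p \<noteq> 0}"

definition weight_count :: "'i set \<Rightarrow> ('i \<Rightarrow> 'a::zero) set \<Rightarrow> nat \<Rightarrow> nat" where
  "weight_count I C j = card {c \<in> C. hamming_weight I c = j}"

definition min_distance :: "'i set \<Rightarrow> ('i \<Rightarrow> 'a::zero) set \<Rightarrow> nat" where
  "min_distance I C = (LEAST j. j \<in> {1..card I} \<and> weight_count I C j \<noteq> 0)"


section \<open>Edge codes\<close>

text \<open>A simple graph on the vertices \<open>1, \<dots>, s\<close> is given by its set of edges, which are two-element
  subsets of \<open>{1..s}\<close>; the vertex \<open>i\<close> stands for \<open>t\<^sub>i\<close>.\<close>

definition cycle_edges :: "nat \<Rightarrow> nat set set" where
  "cycle_edges s = (\<lambda>i. {i, i + 1}) ` {1..s - 1} \<union> {{1, s}}"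

definition edge_space :: "nat set set \<Rightarrow> 'a::field mpoly set" where
  "edge_space E = mpoly.span {var i * var j | i j. {i, j} \<in> E}"

definition torus :: "nat \<Rightarrow> (nat \<Rightarrow> 'a::field) set" where
  "torus s = {1..s} \<rightarrow>\<^sub>E (UNIV - {0})"

text \<open>The coordinates of a codeword are indexed by the points of the torus themselves instead of by an
  enumeration of these points.\<close>

definition edge_code :: "nat \<Rightarrow> nat set set \<Rightarrow> ((nat \<Rightarrow> 'a::field) \<Rightarrow> 'a) set" where
  "edge_code s E = (\<lambda>f. \<lambda>P\<in>torus s. eval_mpoly P f) ` edge_space E"

end

theory Submission
  imports Defs
begin

text \<open>
  Write \<open>n = q - 1\<close>. A polynomial of the edge space is \<open>\<Sum> a\<^sub>i t\<^sub>i t\<^sub>i\<^sub>+\<^sub>1\<close>, and its value at a point of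
  the torus depends only on the edge values \<open>y\<^sub>i = t\<^sub>i t\<^sub>i\<^sub>+\<^sub>1\<close>. For an even cycle these satisfy
  exactly one relation, \<open>y\<^sub>1 y\<^sub>3 y\<^sub>5 \<dots> = y\<^sub>2 y\<^sub>4 y\<^sub>6 \<dots>\<close>, and every vector of units with this relation
  comes from \<open>n\<close> points of the torus (lemma \<open>card_torus_edge_values\<close>). Hence the number of zeros
  of a codeword is \<open>n\<close> times the number of vectors \<open>y\<close> of units such that the alternating product
  \<open>y\<^sub>1 y\<^sub>2\<^sup>-\<^sup>1 y\<^sub>3 y\<^sub>4\<^sup>-\<^sup>1 \<dots>\<close> is \<open>1\<close> and \<open>\<Sum> a\<^sub>i y\<^sub>i = 0\<close>.

  If some coefficient \<open>a\<^sub>j\<close> vanishes, the relation determines \<open>y\<^sub>j\<close> from the other coordinates,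
  which are then free. The zeros of a linear form on a product of units are counted by an
  elementary recursion (\<open>card_linear_zeros\<close>), and the count depends only on the size \<open>r\<close> of the
  support. This gives the weights attached to \<open>r = 1, \<dots>, s - 1\<close>.

  If no coefficient vanishes, the count is computed by removing the coordinates in pairs
  (\<open>fibre_count_rec\<close>). The contribution \<open>a x + b y\<close> of a pair is zero for exactly one ratio
  \<open>e = y / x\<close>. For every other ratio the remaining linear form has to take a non-zero value, and
  all non-zero values are taken equally often, because multiplying all coordinates by a unit
  scales the form and preserves the alternating product, which has as many factors as inverse
  factors. Since the sum of the counts over all values of the alternating product is known as
  well, the count for \<open>k + 1\<close> pairs is \<open>q\<close> times one count for \<open>k\<close> pairs plus a constant. For one
  pair there are only two possible counts, so there are only two for every number of pairs; they
  are distinguished by whether the word is special, which means that the alternating product of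
  the coefficients is \<open>(-1)\<^sup>k\<close> (\<open>fibre_count_zero\<close>).

  It remains to see which of these weights coincide. Different \<open>r < s\<close> give different weights.
  After division by common factors, an equality between a weight for \<open>r < s\<close> and one of the two
  weights for full support reads \<open>n\<^sup>m + 1 = (n + 1)\<^sup>k\<close> with odd \<open>m\<close>, or
  \<open>1 + (n - 1) (n + 1)\<^sup>k = n\<^sup>2\<^sup>h\<close>. For \<open>n, k \<ge> 2\<close> the only solution is \<open>2\<^sup>3 + 1 = 3\<^sup>2\<close>, which is the
  exception \<open>q = 3\<close>, \<open>s = 4\<close>. In particular no weight of a non-zero coefficient vector is zero, so
  words correspond to coefficient vectors and can be counted through the latter. The minimum
  distance is the smaller of the weight for \<open>r = 2\<close> and the weight of the special full-support
  words.
\<close>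

section \<open>Counting functions with values in the units\<close>

abbreviation units :: "'a::zero set" where
  "units \<equiv> UNIV - {0}"

text \<open>Fubini for counting: fixing the value at one new index turns a count over functions on
  \<open>insert i I\<close> into a sum of counts over functions on \<open>I\<close>. All recursions below start from it.\<close>

lemma card_PiE_insert_filter:
  assumes "finite I" "finite S" "i \<notin> I"
  shows "card {z \<in> insert i I \<rightarrow>\<^sub>E S. Q z} = (\<Sum>x\<in>S. card {z \<in> I \<rightarrow>\<^sub>E S. Q (z(i := x))})"
proof -
  let ?A = "SIGMA x:S. {z \<in> I \<rightarrow>\<^sub>E S. Q (z(i := x))}"
  let ?f = "\<lambda>(x, z). z(i := x)"
  have "{z \<in> insert i I \<rightarrow>\<^sub>E S. Q z} = ?f ` ?A"
    unfolding PiE_insert_eq by auto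
  moreover have "inj_on ?f ?A"
    by (rule inj_on_subset[OF inj_combinator[OF assms(3), of "\<lambda>_. S"]]) auto
  ultimately have "card {z \<in> insert i I \<rightarrow>\<^sub>E S. Q z} = card ?A"
    by (simp add: card_image)
  also have "\<dots> = (\<Sum>x\<in>S. card {z \<in> I \<rightarrow>\<^sub>E S. Q (z(i := x))})"
    using assms(1,2) finite_PiE[of I "\<lambda>_. S"] by (intro card_SigmaI) (auto intro: rev_finite_subset)
  finally show ?thesis .
qed

lemma card_filter_partition:
  assumes "finite A" "finite D" "\<And>x. x \<in> A \<Longrightarrow> Q x \<Longrightarrow> f x \<in> D"
  shows "(\<Sum>d\<in>D. card {x \<in> A. Q x \<and> f x = d}) = card {x \<in> A. Q x}"
proof -
  have "{x \<in> A. Q x} = (\<Union>d\<in>D. {x \<in> A. Q x \<and> f x = d})"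
    using assms(3) by auto
  then show ?thesis
    using assms(1,2) by (simp only:, subst card_UN_disjoint) auto
qed

lemma card_units: "card (units :: 'a::{field,finite} set) = CARD('a) - 1"
  by (simp add: card_Diff_singleton)

lemma real_card_units: "real (card (units :: 'a::{field,finite} set)) = real CARD('a) - 1"
proof -
  have "CARD('a) \<ge> 1" by (simp add: Suc_leI)
  then show ?thesis by (simp add: card_units of_nat_diff)
qed

lemma sum_fun_upd_insert:
  fixes a z :: "'i \<Rightarrow> 'a::comm_ring"
  assumes "finite J" "i \<notin> J"
  shows "(\<Sum>l\<in>insert i J. a l * (z(i := x)) l) = a i * x + (\<Sum>l\<in>J. a l * z l)"
proof -
  have "(\<Sum>l\<in>J. a l * (z(i := x)) l) = (\<Sum>l\<in>J. a l * z l)"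
    using assms by (intro sum.cong) auto
  then show ?thesis using assms by simp
qed

text \<open>Indices with \<open>a i = 0\<close> contribute a free factor \<open>n\<close>. Adding an index with \<open>a i \<noteq> 0\<close> replaces the
  number of zeros by the number of non-zeros: whenever the old form is non-zero, exactly one unit
  at the new index cancels it, and none does when the old form is zero. Iterating
  \<open>Z \<mapsto> n ^ card J - Z\<close> gives the alternating sign.\<close>

lemma card_linear_zeros:
  fixes a :: "'i \<Rightarrow> 'a::{field,finite}"
  defines "n \<equiv> real CARD('a) - 1"
  assumes "finite J"
  shows "real CARD('a) * real (card {y \<in> J \<rightarrow>\<^sub>E units. (\<Sum>i\<in>J. a i * y i) = 0})
    = n ^ card J + (-1) ^ card {i \<in> J. a i \<noteq> 0} * n ^ (card J - card {i \<in> J. a i \<noteq> 0} + 1)"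
  using assms(2)
proof (induction J)
  case empty
  then show ?case by (simp add: n_def)
next
  case (insert i J)
  let ?r = "card {l \<in> J. a l \<noteq> 0}"
  let ?Z = "card {y \<in> J \<rightarrow>\<^sub>E units. (\<Sum>l\<in>J. a l * y l) = 0}"
  let ?Z' = "card {y \<in> insert i J \<rightarrow>\<^sub>E units. (\<Sum>l\<in>insert i J. a l * y l) = 0}"
  have r: "?r \<le> card J" by (simp add: card_mono insert.hyps)
  have n: "real (card (units :: 'a set)) = n" by (simp add: n_def real_card_units)
  have split: "?Z' = (\<Sum>x\<in>units. card {y \<in> J \<rightarrow>\<^sub>E units. a i * x + (\<Sum>l\<in>J. a l * y l) = 0})"
    using card_PiE_insert_filter[OF insert.hyps(1) _ insert.hyps(2), of units
        "\<lambda>y. (\<Sum>l\<in>insert i J. a l * y l) = 0"]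
    unfolding sum_fun_upd_insert[OF insert.hyps] by simp
  show ?case
  proof (cases "a i = 0")
    case True
    have "real ?Z' = n * real ?Z"
      unfolding split using True n by simp
    moreover have "{l \<in> insert i J. a l \<noteq> 0} = {l \<in> J. a l \<noteq> 0}" using True by auto
    ultimately show ?thesis
      using insert.IH insert.hyps r by (simp add: algebra_simps Suc_diff_le)
  next
    case False
    have fin: "finite (J \<rightarrow>\<^sub>E (units :: 'a set))" using insert.hyps by (intro finite_PiE) auto
    \<comment> \<open>As \<open>x\<close> runs through the units, so does the value \<open>- (a i * x)\<close> required of the old form.\<close>
    have "?Z' = (\<Sum>d\<in>units. card {y \<in> J \<rightarrow>\<^sub>E units. (\<Sum>l\<in>J. a l * y l) = d})"
      unfolding split
      by (rule sum.reindex_bij_witness[of _ "\<lambda>d. - d / a i" "\<lambda>x. - (a i * x)"])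
        (use False in \<open>auto intro!: arg_cong[where f = card] simp: add_eq_0_iff2 add_eq_0_iff\<close>)
    also have "\<dots> = (\<Sum>d\<in>units. card {y \<in> J \<rightarrow>\<^sub>E units. (\<Sum>l\<in>J. a l * y l) \<noteq> 0 \<and> (\<Sum>l\<in>J. a l * y l) = d})"
      by (intro sum.cong arg_cong[where f = card]) auto
    also have "\<dots> = card {y \<in> J \<rightarrow>\<^sub>E units. (\<Sum>l\<in>J. a l * y l) \<noteq> 0}"
      by (rule card_filter_partition) (use fin in auto)
    also have "{y \<in> J \<rightarrow>\<^sub>E units. (\<Sum>l\<in>J. a l * y l) \<noteq> 0}
        = (J \<rightarrow>\<^sub>E units) - {y \<in> J \<rightarrow>\<^sub>E units. (\<Sum>l\<in>J. a l * y l) = 0}" by auto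
    also have "card \<dots> = card (J \<rightarrow>\<^sub>E (units :: 'a set)) - ?Z"
      using fin by (intro card_Diff_subset) auto
    finally have "real ?Z' = real (card (J \<rightarrow>\<^sub>E (units :: 'a set))) - real ?Z"
      using fin by (simp add: of_nat_diff card_mono)
    also have "real (card (J \<rightarrow>\<^sub>E (units :: 'a set))) = n ^ card J"
      using insert.hyps n by (simp add: card_PiE)
    finally have Z': "real ?Z' = n ^ card J - real ?Z" .
    have "{l \<in> insert i J. a l \<noteq> 0} = insert i {l \<in> J. a l \<noteq> 0}" using False by auto
    then have "card {l \<in> insert i J. a l \<noteq> 0} = Suc ?r" using insert.hyps by simp
    then show ?thesis
      unfolding Z' right_diff_distrib insert.IH
      using insert.hyps by (simp add: n_def algebra_simps)
  qed
qed

section \<open>Alternating products\<close>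

text \<open>The edge values of an even cycle are the vectors of units on which this monomial with exponents
  \<open>1, -1, 1, -1, \<dots>\<close> equals \<open>1\<close>. With inverses instead of an equation between two products, one
  factor per index can be split off, whatever its parity.\<close>

definition alt_prod :: "nat set \<Rightarrow> (nat \<Rightarrow> 'a::field) \<Rightarrow> 'a" where
  "alt_prod J y = (\<Prod>i\<in>J. if odd i then y i else inverse (y i))"

lemma alt_prod_cong: "(\<And>i. i \<in> J \<Longrightarrow> y i = z i) \<Longrightarrow> alt_prod J y = alt_prod J z"
  unfolding alt_prod_def by (intro prod.cong) auto

lemma alt_prod_insert:
  assumes "finite J" "i \<notin> J"
  shows "alt_prod (insert i J) (y(i := x)) = (if odd i then x else inverse x) * alt_prod J y"
proof -
  have "alt_prod J (y(i := x)) = alt_prod J y" using assms(2) by (intro alt_prod_cong) auto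
  then show ?thesis using assms by (simp add: alt_prod_def)
qed

lemma alt_prod_nonzero:
  assumes "finite J" "y \<in> J \<rightarrow>\<^sub>E units"
  shows "alt_prod J y \<noteq> 0"
  using assms by (auto simp: alt_prod_def prod_zero_iff PiE_def Pi_def)

text \<open>Every coordinate occurs in the alternating product with exponent \<open>1\<close> or \<open>-1\<close>, so the prescribed
  value \<open>c\<close> determines the coordinate \<open>j\<close> from the others. A further condition \<open>R\<close> is carried
  along as long as it does not look at \<open>j\<close>.\<close>

lemma card_alt_prod_fibre:
  fixes c :: "'a::{field,finite}"
  assumes "finite J" "j \<in> J" "c \<noteq> 0" "\<And>y x. R (y(j := x)) \<longleftrightarrow> R y"
  shows "card {y \<in> J \<rightarrow>\<^sub>E units. alt_prod J y = c \<and> R y} = card {y \<in> (J - {j}) \<rightarrow>\<^sub>E units. R y}"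
proof -
  let ?I = "J - {j}"
  let ?g = "\<lambda>x::'a. if odd j then x else inverse x"
  have alt: "alt_prod J (y(j := x)) = ?g x * alt_prod ?I y" for x y
    using alt_prod_insert[of ?I j y x] assms(1,2) by (simp add: insert_absorb)
  have fin: "finite (?I \<rightarrow>\<^sub>E (units :: 'a set))" using assms by (intro finite_PiE) auto
  have solve: "?g x * alt_prod ?I y = c \<longleftrightarrow> ?g (c / alt_prod ?I y) = x"
    if "x \<in> units" "y \<in> ?I \<rightarrow>\<^sub>E units" for x :: 'a and y
  proof -
    have "alt_prod ?I y \<noteq> 0" using that(2) assms(1) alt_prod_nonzero by blast
    then show ?thesis using assms(3) that(1) by (auto simp: field_simps)
  qed
  have "card {y \<in> J \<rightarrow>\<^sub>E units. alt_prod J y = c \<and> R y}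
      = (\<Sum>x\<in>units. card {y \<in> ?I \<rightarrow>\<^sub>E units. ?g x * alt_prod ?I y = c \<and> R y})"
    using card_PiE_insert_filter[of ?I units j "\<lambda>y. alt_prod J y = c \<and> R y"] assms alt
    by (simp add: insert_absorb del: fun_upd_apply)
  also have "\<dots> = (\<Sum>x\<in>units. card {y \<in> ?I \<rightarrow>\<^sub>E units. R y \<and> ?g (c / alt_prod ?I y) = x})"
    by (intro sum.cong arg_cong[where f = card] Collect_cong refl) (use solve in blast)
  also have "\<dots> = card {y \<in> ?I \<rightarrow>\<^sub>E units. R y}"
  proof (rule card_filter_partition[OF fin])
    fix y assume "y \<in> ?I \<rightarrow>\<^sub>E (units :: 'a set)"
    then have "alt_prod ?I y \<noteq> 0" using assms(1) alt_prod_nonzero by blast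
    then show "?g (c / alt_prod ?I y) \<in> units" using assms(3) by simp
  qed simp
  finally show ?thesis .
qed

lemma card_alt_prod:
  fixes c :: "'a::{field,finite}"
  assumes "finite J" "J \<noteq> {}" "c \<noteq> 0"
  shows "card {y \<in> J \<rightarrow>\<^sub>E units. alt_prod J y = c} = (CARD('a) - 1) ^ (card J - 1)"
proof -
  obtain j where "j \<in> J" using assms(2) by auto
  then show ?thesis
    using card_alt_prod_fibre[of J j c "\<lambda>_. True"] assms
    by (simp add: card_PiE card_units)
qed

section \<open>Values of the edge monomials of an even cycle on the torus\<close>

definition nxt :: "nat \<Rightarrow> nat \<Rightarrow> nat" where
  "nxt s i = (if i = s then 1 else i + 1)"

text \<open>Restricted to \<open>{1..s}\<close>, so that the edge values of a point of the torus form a point of the torus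
  again.\<close>

definition edge_values :: "nat \<Rightarrow> (nat \<Rightarrow> 'a::field) \<Rightarrow> nat \<Rightarrow> 'a" where
  "edge_values s t = (\<lambda>i\<in>{1..s}. t i * t (nxt s i))"

text \<open>Along a path the alternating product of the edge values telescopes. The cycle is treated as a path
  by giving the additional vertex \<open>s + 1\<close> the value of the vertex \<open>1\<close>.\<close>

lemma alt_prod_path:
  fixes t :: "nat \<Rightarrow> 'a::field"
  assumes "\<And>i. i \<in> {1..2 * k + 1} \<Longrightarrow> t i \<noteq> 0"
  shows "alt_prod {1..2 * k} (\<lambda>i. t i * t (i + 1)) = t 1 / t (2 * k + 1)"
  using assms
proof (induction k)
  case 0
  then show ?case by (simp add: alt_prod_def)
next
  case (Suc k)
  have nz: "t (2*k+1) \<noteq> 0" "t (2*k+2) \<noteq> 0" "t (2*k+3) \<noteq> 0" by (simp_all add: Suc.prems)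
  have IH: "alt_prod {1..2 * k} (\<lambda>i. t i * t (i + 1)) = t 1 / t (2 * k + 1)"
    by (rule Suc.IH) (simp add: Suc.prems)
  have "alt_prod {1..2 * Suc k} (\<lambda>i. t i * t (i + 1))
      = alt_prod {1..2 * k} (\<lambda>i. t i * t (i + 1))
        * (t (2*k+1) * t (2*k+2) * inverse (t (2*k+2) * t (2*k+3)))"
    by (simp add: alt_prod_def numeral_3_eq_3 mult.assoc)
  also have "\<dots> = t 1 / t (2 * Suc k + 1)"
    unfolding IH using nz by (simp add: field_simps numeral_3_eq_3)
  finally show ?case .
qed

lemma alt_prod_edge_values:
  assumes "s = 2 * k" "k \<ge> 1" "t \<in> torus s"
  shows "alt_prod {1..s} (edge_values s t) = 1"
proof -
  let ?t = "t(s + 1 := t 1)"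
  have nz: "t i \<noteq> 0" if "i \<in> {1..s}" for i
    using assms(3) that by (auto simp: torus_def PiE_def Pi_def)
  have "alt_prod {1..s} (edge_values s t) = alt_prod {1..s} (\<lambda>i. ?t i * ?t (i + 1))"
    by (rule alt_prod_cong) (auto simp: edge_values_def nxt_def)
  also have "\<dots> = ?t 1 / ?t (2 * k + 1)"
    unfolding assms(1) by (rule alt_prod_path) (use nz assms in \<open>auto simp: le_Suc_eq\<close>)
  also have "\<dots> = 1" using nz assms by simp
  finally show ?thesis .
qed

text \<open>Each edge value determines the next vertex from the previous one.\<close>

lemma edge_values_inj:
  assumes "t \<in> torus s" "t' \<in> torus s" "t 1 = t' 1" "edge_values s t = edge_values s t'"
  shows "t = t'"
proof (rule PiE_ext)
  show "t \<in> {1..s} \<rightarrow>\<^sub>E units" "t' \<in> {1..s} \<rightarrow>\<^sub>E units"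
    using assms by (simp_all add: torus_def)
  fix i assume "i \<in> {1..s}"
  then have "1 \<le> i" "i \<le> s" by auto
  then show "t i = t' i"
  proof (induction i rule: dec_induct)
    case base
    then show ?case using assms by simp
  next
    case (step m)
    have "t m * t (m + 1) = t' m * t' (m + 1)"
      using fun_cong[OF assms(4), of m] step by (simp add: edge_values_def nxt_def)
    moreover have "t m = t' m" using step by simp
    moreover have "t m \<noteq> 0" using assms(1) step by (auto simp: torus_def PiE_def Pi_def)
    ultimately show ?case by simp
  qed
qed

lemma card_torus: "card (torus s :: (nat \<Rightarrow> 'a::{field,finite}) set) = (CARD('a) - 1) ^ s"
  by (simp add: torus_def card_PiE card_units)

lemma finite_torus: "finite (torus s :: (nat \<Rightarrow> 'a::{field,finite}) set)"
  unfolding torus_def by (intro finite_PiE) auto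

text \<open>The value at vertex \<open>1\<close> together with the edge values determines a point of the torus, and the
  edge values have alternating product \<open>1\<close>. This injection into pairs is onto because both sides
  have \<open>(q - 1) ^ s\<close> elements.\<close>

lemma card_torus_edge_values:
  fixes R :: "(nat \<Rightarrow> 'a::{field,finite}) \<Rightarrow> bool"
  assumes "s = 2 * k" "k \<ge> 1"
  shows "card {t \<in> torus s. R (edge_values s t)}
    = (CARD('a) - 1) * card {y \<in> torus s. alt_prod {1..s} y = 1 \<and> R y}"
proof -
  let ?H = "{y \<in> torus s. alt_prod {1..s} y = (1::'a)}"
  let ?\<Psi> = "\<lambda>t :: nat \<Rightarrow> 'a. (t 1, edge_values s t)"
  have inj: "inj_on ?\<Psi> (torus s)"
    by (rule inj_onI) (simp add: edge_values_inj)
  have sub: "?\<Psi> ` torus s \<subseteq> units \<times> ?H"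
  proof (rule image_subsetI)
    fix t :: "nat \<Rightarrow> 'a"
    assume t: "t \<in> torus s"
    then have nz: "t i \<noteq> 0" if "i \<in> {1..s}" for i
      using that by (auto simp: torus_def PiE_def Pi_def)
    then have "edge_values s t \<in> torus s"
      by (auto simp: torus_def edge_values_def nxt_def)
    then show "?\<Psi> t \<in> units \<times> ?H"
      using nz alt_prod_edge_values[OF assms t] assms by simp
  qed
  have "card (?\<Psi> ` torus s) = card ((units :: 'a set) \<times> ?H)"
  proof -
    have "card ?H = (CARD('a) - 1) ^ (s - 1)"
      using card_alt_prod[of "{1..s}" "1::'a"] assms by (simp add: torus_def)
    then have "card ((units :: 'a set) \<times> ?H) = (CARD('a) - 1) ^ s"
      using assms by (simp only: card_cartesian_product card_units) (simp add: power_eq_if)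
    moreover have "card (?\<Psi> ` torus s) = (CARD('a) - 1) ^ s"
      by (simp only: card_image[OF inj] card_torus)
    ultimately show ?thesis by (simp only:)
  qed
  then have im: "?\<Psi> ` torus s = units \<times> ?H"
    by (intro card_subset_eq[OF _ sub] finite_cartesian_product)
      (auto intro: finite_subset[OF _ finite_torus[of s]])
  have "?\<Psi> ` {t \<in> torus s. R (edge_values s t)} = {p \<in> ?\<Psi> ` torus s. R (snd p)}" by auto
  also have "\<dots> = units \<times> {y \<in> torus s. alt_prod {1..s} y = 1 \<and> R y}"
    unfolding im by auto
  finally have "card (?\<Psi> ` {t \<in> torus s. R (edge_values s t)})
      = (CARD('a) - 1) * card {y \<in> torus s. alt_prod {1..s} y = 1 \<and> R y}"
    by (simp add: card_cartesian_product card_units)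
  moreover have "inj_on ?\<Psi> {t \<in> torus s. R (edge_values s t)}"
    by (rule inj_on_subset[OF inj]) auto
  ultimately show ?thesis by (simp add: card_image)
qed

section \<open>Linear forms on a fibre of the alternating product\<close>

text \<open>The recursion on the number of pairs of coordinates shifts both the value \<open>c\<close> of the alternating
  product and the value \<open>d\<close> of the linear form, so both are parameters.\<close>

definition fibre_count :: "nat \<Rightarrow> (nat \<Rightarrow> 'a::field) \<Rightarrow> 'a \<Rightarrow> 'a \<Rightarrow> nat" where
  "fibre_count s a c d
    = card {y \<in> torus s. alt_prod {1..s} y = c \<and> (\<Sum>i\<in>{1..s}. a i * y i) = d}"

lemma alt_prod_scale:
  assumes "l \<noteq> (0::'a::field)"
  shows "alt_prod {1..2 * k} (\<lambda>i. l * y i) = alt_prod {1..2 * k} y"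
proof (induction k)
  case 0
  then show ?case by (simp add: alt_prod_def)
next
  case (Suc k)
  have "alt_prod {1..2 * Suc k} z
      = alt_prod {1..2 * k} z * (z (2 * k + 1) * inverse (z (2 * k + 2)))" for z :: "nat \<Rightarrow> 'a"
    by (simp add: alt_prod_def mult.assoc)
  then show ?case using Suc assms by simp
qed

text \<open>Multiplying all coordinates by a unit keeps the alternating product of an even number of factors
  and multiplies the linear form.\<close>

lemma fibre_count_scale:
  assumes "d \<noteq> (0::'a::{field,finite})"
  shows "fibre_count (2 * k) a c d = fibre_count (2 * k) a c 1"
  unfolding fibre_count_def
proof (rule bij_betw_same_card)
  let ?sc = "\<lambda>l y. \<lambda>i\<in>{1..2 * k}. (l::'a) * y i"
  have sc: "?sc l y \<in> {y \<in> torus (2 * k). alt_prod {1..2 * k} y = c \<and> (\<Sum>i\<in>{1..2 * k}. a i * y i) = l * e}"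
    if "l \<noteq> 0" "y \<in> {y \<in> torus (2 * k). alt_prod {1..2 * k} y = c \<and> (\<Sum>i\<in>{1..2 * k}. a i * y i) = e}"
    for l y e
  proof -
    have "alt_prod {1..2 * k} (?sc l y) = alt_prod {1..2 * k} y"
      using alt_prod_scale[OF that(1), of k y] by (subst alt_prod_cong[of _ _ "\<lambda>i. l * y i"]) auto
    moreover have "(\<Sum>i\<in>{1..2 * k}. a i * ?sc l y i) = l * (\<Sum>i\<in>{1..2 * k}. a i * y i)"
      by (simp add: sum_distrib_left mult.left_commute)
    moreover have "?sc l y \<in> torus (2 * k)"
      using that by (auto simp: torus_def PiE_def Pi_def)
    ultimately show ?thesis using that(2) by simp
  qed
  have inv: "?sc l (?sc m y) = y" if "y \<in> torus (2 * k)" "l * m = 1" for l m y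
    using that by (auto simp: torus_def PiE_def extensional_def mult.assoc[symmetric])
  show "bij_betw (?sc (inverse d))
      {y \<in> torus (2 * k). alt_prod {1..2 * k} y = c \<and> (\<Sum>i\<in>{1..2 * k}. a i * y i) = d}
      {y \<in> torus (2 * k). alt_prod {1..2 * k} y = c \<and> (\<Sum>i\<in>{1..2 * k}. a i * y i) = 1}"
  proof (rule bij_betw_byWitness[where f' = "?sc d"])
    show "?sc (inverse d) ` {y \<in> torus (2 * k). alt_prod {1..2 * k} y = c \<and> (\<Sum>i\<in>{1..2 * k}. a i * y i) = d}
        \<subseteq> {y \<in> torus (2 * k). alt_prod {1..2 * k} y = c \<and> (\<Sum>i\<in>{1..2 * k}. a i * y i) = 1}"
      using sc[of "inverse d" _ d] assms by (intro image_subsetI) simp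
    show "?sc d ` {y \<in> torus (2 * k). alt_prod {1..2 * k} y = c \<and> (\<Sum>i\<in>{1..2 * k}. a i * y i) = 1}
        \<subseteq> {y \<in> torus (2 * k). alt_prod {1..2 * k} y = c \<and> (\<Sum>i\<in>{1..2 * k}. a i * y i) = d}"
      using sc[of d _ 1] assms by (intro image_subsetI) simp
  qed (use inv assms in auto)
qed

text \<open>The values \<open>d\<close> partition a fibre of the alternating product, and all \<open>d \<noteq> 0\<close> have the same count.
  Hence the count at \<open>d = 1\<close> is determined by the one at \<open>d = 0\<close>.\<close>

lemma fibre_count_total:
  fixes c :: "'a::{field,finite}"
  assumes "k \<ge> 1" "c \<noteq> 0"
  shows "real (fibre_count (2 * k) a c 0) + (real CARD('a) - 1) * real (fibre_count (2 * k) a c 1)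
    = (real CARD('a) - 1) ^ (2 * k - 1)"
proof -
  have "(\<Sum>d\<in>UNIV. fibre_count (2 * k) a c d) = card {y \<in> torus (2 * k). alt_prod {1..2 * k} y = c}"
    unfolding fibre_count_def by (rule card_filter_partition) (auto intro: finite_torus)
  also have "\<dots> = (CARD('a) - 1) ^ (2 * k - 1)"
    using card_alt_prod[of "{1..2 * k}" c] assms by (simp add: torus_def)
  also have "(\<Sum>d\<in>UNIV. fibre_count (2 * k) a c d)
      = fibre_count (2 * k) a c 0 + (\<Sum>d\<in>units. fibre_count (2 * k) a c d)"
    by (subst sum.remove[of _ 0]) auto
  also have "(\<Sum>d\<in>units. fibre_count (2 * k) a c d)
      = (\<Sum>d\<in>(units :: 'a set). fibre_count (2 * k) a c 1)"
    by (intro sum.cong fibre_count_scale) auto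
  also have "\<dots> = (CARD('a) - 1) * fibre_count (2 * k) a c 1"
    by (simp add: card_units)
  finally have "real (fibre_count (2 * k) a c 0 + (CARD('a) - 1) * fibre_count (2 * k) a c 1)
      = real ((CARD('a) - 1) ^ (2 * k - 1))" by simp
  moreover have "real (CARD('a) - 1) = real CARD('a) - 1"
    using real_card_units[where 'a = 'a] card_units[where 'a = 'a] by simp
  ultimately show ?thesis by simp
qed

text \<open>Summing over the fibres forgets the condition on the alternating product, which leaves the zeros
  of the linear form on the whole torus.\<close>

lemma fibre_count_sum:
  fixes a :: "nat \<Rightarrow> 'a::{field,finite}"
  assumes "\<And>i. i \<in> {1..2 * k} \<Longrightarrow> a i \<noteq> 0"
  shows "real CARD('a) * real (\<Sum>c\<in>units. fibre_count (2 * k) a c 0)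
    = (real CARD('a) - 1) ^ (2 * k) + (real CARD('a) - 1)"
proof -
  have "(\<Sum>c\<in>units. fibre_count (2 * k) a c 0)
      = (\<Sum>c\<in>units. card {y \<in> torus (2 * k). (\<Sum>i\<in>{1..2 * k}. a i * y i) = 0 \<and> alt_prod {1..2 * k} y = c})"
    unfolding fibre_count_def by (intro sum.cong arg_cong[where f = card]) auto
  also have "\<dots> = card {y \<in> torus (2 * k). (\<Sum>i\<in>{1..2 * k}. a i * y i) = 0}"
    by (rule card_filter_partition[OF finite_torus])
      (auto simp: torus_def dest: alt_prod_nonzero[rotated])
  finally have "(\<Sum>c\<in>units. fibre_count (2 * k) a c 0)
      = card {y \<in> {1..2 * k} \<rightarrow>\<^sub>E units. (\<Sum>i\<in>{1..2 * k}. a i * y i) = 0}"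
    by (simp add: torus_def)
  moreover have "{i \<in> {1..2 * k}. a i \<noteq> 0} = {1..2 * k}" using assms by auto
  ultimately show ?thesis
    using card_linear_zeros[of "{1..2 * k}" a] by simp
qed

text \<open>Here \<open>x\<close> is the coordinate \<open>2 * k + 1\<close> and \<open>e\<close> is the ratio of the coordinate \<open>2 * k + 2\<close> to \<open>x\<close>.
  The pair enters the alternating product only through \<open>e\<close>.\<close>

lemma fibre_count_Suc:
  fixes a :: "nat \<Rightarrow> 'a::{field,finite}"
  assumes "c \<noteq> 0"
  shows "fibre_count (2 * Suc k) a c 0
    = (\<Sum>x\<in>units. \<Sum>e\<in>units.
        fibre_count (2 * k) a (c * e) (- (x * (a (2 * k + 1) + a (2 * k + 2) * e))))"
proof -
  let ?I = "{1..2 * k}"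
  let ?i = "2 * k + 1" and ?j = "2 * k + 2"
  have J: "{1..2 * Suc k} = insert ?j (insert ?i ?I)" by auto
  have nin: "?i \<notin> ?I" "?j \<notin> insert ?i ?I" by auto
  have alt: "alt_prod {1..2 * Suc k} (z(?i := x, ?j := y)) = x * inverse y * alt_prod ?I z"
    for x y :: 'a and z
    unfolding J using nin by (simp add: alt_prod_insert del: fun_upd_apply)
  have lin: "(\<Sum>i\<in>{1..2 * Suc k}. a i * (z(?i := x, ?j := y)) i)
      = a ?j * y + (a ?i * x + (\<Sum>i\<in>?I. a i * z i))" for x y z
    unfolding J by (simp only: sum_fun_upd_insert[OF _ nin(1)] sum_fun_upd_insert[OF _ nin(2)]
        finite_insert finite_atLeastAtMost)
  have "fibre_count (2 * Suc k) a c 0 = (\<Sum>y\<in>units. \<Sum>x\<in>units.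
      card {z \<in> ?I \<rightarrow>\<^sub>E units. x * inverse y * alt_prod ?I z = c
        \<and> a ?j * y + (a ?i * x + (\<Sum>i\<in>?I. a i * z i)) = 0})"
    unfolding fibre_count_def torus_def alt[symmetric] lin[symmetric] unfolding J
    by (simp only: card_PiE_insert_filter[OF _ _ nin(1)] card_PiE_insert_filter[OF _ _ nin(2)] finite_insert finite_atLeastAtMost finite)
  also have "\<dots> = (\<Sum>x\<in>units. \<Sum>y\<in>units.
      card {z \<in> ?I \<rightarrow>\<^sub>E units. x * inverse y * alt_prod ?I z = c
        \<and> a ?j * y + (a ?i * x + (\<Sum>i\<in>?I. a i * z i)) = 0})"
    by (rule sum.swap)
  also have "\<dots> = (\<Sum>x\<in>units. \<Sum>e\<in>units.
        fibre_count (2 * k) a (c * e) (- (x * (a ?i + a ?j * e))))"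
  proof (rule sum.cong[OF refl])
    fix x :: 'a assume x: "x \<in> units"
    show "(\<Sum>y\<in>units. card {z \<in> ?I \<rightarrow>\<^sub>E units. x * inverse y * alt_prod ?I z = c
        \<and> a ?j * y + (a ?i * x + (\<Sum>i\<in>?I. a i * z i)) = 0})
      = (\<Sum>e\<in>units. fibre_count (2 * k) a (c * e) (- (x * (a ?i + a ?j * e))))"
    proof (rule sum.reindex_bij_witness[of _ "\<lambda>e. x * e" "\<lambda>y. y / x"])
      fix y :: 'a assume y: "y \<in> units"
      have "x * inverse y * p = c \<longleftrightarrow> p = c * (y / x)" for p
        using x y by (auto simp: field_simps)
      moreover have "a ?j * y + (a ?i * x + S) = 0 \<longleftrightarrow> S = - (x * (a ?i + a ?j * (y / x)))" for S
      proof -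
        have "x * (a ?i + a ?j * (y / x)) = a ?j * y + a ?i * x"
          using x by (simp add: field_simps)
        then show ?thesis by (simp only: eq_neg_iff_add_eq_0 ac_simps)
      qed
      ultimately show "fibre_count (2 * k) a (c * (y / x)) (- (x * (a ?i + a ?j * (y / x))))
        = card {z \<in> ?I \<rightarrow>\<^sub>E units. x * inverse y * alt_prod ?I z = c
        \<and> a ?j * y + (a ?i * x + (\<Sum>i\<in>?I. a i * z i)) = 0}"
        unfolding fibre_count_def torus_def by simp
    qed (use x in auto)
  qed
  finally show ?thesis .
qed

text \<open>The ratio \<open>e0\<close> is the one for which the last two terms of the linear form cancel. For the other
  ratios the value required of the remaining form is non-zero and can be replaced by \<open>1\<close>, so that
  nothing depends on \<open>x\<close> any more.\<close>

lemma fibre_count_rec: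
  fixes a :: "nat \<Rightarrow> 'a::{field,finite}"
  defines "n \<equiv> real CARD('a) - 1"
  assumes "c \<noteq> 0" "a (2 * k + 1) \<noteq> 0" "a (2 * k + 2) \<noteq> 0"
  defines "e0 \<equiv> - a (2 * k + 1) / a (2 * k + 2)"
  shows "real (fibre_count (2 * Suc k) a c 0)
    = n * real (fibre_count (2 * k) a (c * e0) 0)
      + n * (\<Sum>e\<in>units - {e0}. real (fibre_count (2 * k) a (c * e) 1))"
proof -
  have n: "real (card (units :: 'a set)) = n" by (simp add: n_def real_card_units)
  have e0: "e0 \<in> units" using assms by simp
  have zero: "a (2 * k + 1) + a (2 * k + 2) * e = 0 \<longleftrightarrow> e = e0" for e
    using assms(3,4) unfolding e0_def by (auto simp: field_simps add_eq_0_iff)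
  have "fibre_count (2 * Suc k) a c 0
      = (\<Sum>x\<in>(units :: 'a set). fibre_count (2 * k) a (c * e0) 0
          + (\<Sum>e\<in>units - {e0}. fibre_count (2 * k) a (c * e) 1))"
    unfolding fibre_count_Suc[OF assms(2)]
  proof (rule sum.cong[OF refl])
    fix x :: 'a assume x: "x \<in> units"
    have "(\<Sum>e\<in>units. fibre_count (2 * k) a (c * e) (- (x * (a (2 * k + 1) + a (2 * k + 2) * e))))
      = fibre_count (2 * k) a (c * e0) (- (x * (a (2 * k + 1) + a (2 * k + 2) * e0)))
        + (\<Sum>e\<in>units - {e0}. fibre_count (2 * k) a (c * e) (- (x * (a (2 * k + 1) + a (2 * k + 2) * e))))"
      using e0 by (intro sum.remove) auto
    also have "- (x * (a (2 * k + 1) + a (2 * k + 2) * e0)) = 0"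
      using zero[of e0] by simp
    also have "(\<Sum>e\<in>units - {e0}. fibre_count (2 * k) a (c * e) (- (x * (a (2 * k + 1) + a (2 * k + 2) * e))))
        = (\<Sum>e\<in>units - {e0}. fibre_count (2 * k) a (c * e) 1)"
      using x zero by (intro sum.cong fibre_count_scale) auto
    finally show "(\<Sum>e\<in>units. fibre_count (2 * k) a (c * e) (- (x * (a (2 * k + 1) + a (2 * k + 2) * e))))
      = fibre_count (2 * k) a (c * e0) 0 + (\<Sum>e\<in>units - {e0}. fibre_count (2 * k) a (c * e) 1)" .
  qed
  then show ?thesis using n by (simp add: distrib_left)
qed

text \<open>By \<open>fibre_count_total\<close> and \<open>fibre_count_sum\<close>, the sum over the ratios \<open>e \<noteq> e0\<close> in the recursion is
  a constant plus the count at \<open>e0\<close>. In total, the count at \<open>e0\<close> is multiplied by \<open>q\<close>, and a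
  constant independent of \<open>c\<close> is added. Each step multiplies \<open>c\<close> by \<open>e0 = - a\<^sub>i / a\<^sub>i\<^sub>+\<^sub>1\<close>, which
  explains why the two cases are separated by \<open>c\<close> times the alternating product of \<open>a\<close>, with sign
  \<open>(-1) ^ k\<close>.\<close>

lemma fibre_count_zero:
  fixes a :: "nat \<Rightarrow> 'a::{field,finite}"
  defines "q \<equiv> real CARD('a)"
  assumes "k \<ge> 1" "c \<noteq> 0" "\<And>i. i \<in> {1..2 * k} \<Longrightarrow> a i \<noteq> 0"
  shows "q * real (fibre_count (2 * k) a c 0)
    = (q - 1) ^ (2 * k - 1) + 1 - q ^ k
      + (if c * alt_prod {1..2 * k} a = (-1) ^ k then q ^ k * (q - 1) else 0)"
  using assms(2-)
proof (induction k arbitrary: c rule: dec_induct)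
  case base
  let ?e0 = "- a 1 / a 2"
  have nz: "a 1 \<noteq> 0" "a 2 \<noteq> 0" using base.prems(2) by auto
  have two: "2 * Suc 0 = 2" by simp
  have F0: "fibre_count 0 a c' d = (if c' = 1 \<and> d = 0 then 1 else 0)" for c' d
  proof -
    have "{y \<in> torus 0. alt_prod {1..0} y = c' \<and> (\<Sum>i\<in>{1..0}. a i * y i) = d}
        = (if c' = 1 \<and> d = 0 then {\<lambda>_. undefined} else {})"
      by (auto simp: torus_def alt_prod_def)
    then show ?thesis by (simp add: fibre_count_def)
  qed
  have "real (fibre_count 2 a c 0) = (q - 1) * (if c * ?e0 = 1 then 1 else 0)"
    using fibre_count_rec[of c a 0, unfolded mult_0_right add_0 two] base.prems(1) nz
    by (simp add: F0 q_def)
  moreover have "c * ?e0 = 1 \<longleftrightarrow> c * alt_prod {1..2} a = -1"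
  proof -
    have "alt_prod {1..2} a = a 1 * inverse (a 2)"
      by (simp add: alt_prod_def numeral_2_eq_2)
    then have "c * alt_prod {1..2} a = - (c * ?e0)" by (simp add: divide_inverse)
    then show ?thesis by (metis minus_minus)
  qed
  ultimately have "real (fibre_count 2 a c 0) = (if c * alt_prod {1..2} a = -1 then q - 1 else 0)"
    by simp
  then show ?case
    by (simp add: algebra_simps del: One_nat_def)
next
  case (step k)
  let ?e0 = "- a (2 * k + 1) / a (2 * k + 2)"
  let ?n = "q - 1"
  let ?F = "\<lambda>c d. real (fibre_count (2 * k) a c d)"
  have nz: "a i \<noteq> 0" if "i \<in> {1..2 * Suc k}" for i using step.prems(2) that by blast
  have ij: "a (2 * k + 1) \<noteq> 0" "a (2 * k + 2) \<noteq> 0" using nz[of "2 * k + 1"] nz[of "2 * k + 2"] by simp_all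
  have e0: "?e0 \<in> units" using ij by simp
  have q: "q > 1"
  proof -
    have "card {0, 1 :: 'a} \<le> CARD('a)" by (rule card_mono) auto
    then show ?thesis by (simp add: q_def)
  qed
  have card: "real (card (units - {?e0})) = ?n - 1"
    using e0 real_card_units[where 'a = 'a] q by (simp add: card_Diff_singleton q_def of_nat_diff)
  have S: "q * (\<Sum>e\<in>units. ?F (c * e) 0) = ?n ^ (2 * k) + ?n"
  proof -
    have "(\<Sum>e\<in>units. ?F (c * e) 0) = (\<Sum>e\<in>units. ?F e 0)"
      by (rule sum.reindex_bij_witness[of _ "\<lambda>e. e / c" "\<lambda>e. c * e"]) (use step.prems(1) in auto)
    then show ?thesis using fibre_count_sum[of k a] nz by (simp add: q_def)
  qed
  have "(\<Sum>e\<in>units - {?e0}. ?n * ?F (c * e) 1) = (\<Sum>e\<in>units - {?e0}. ?n ^ (2 * k - 1) - ?F (c * e) 0)"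
  proof (rule sum.cong[OF refl])
    fix e assume "e \<in> units - {?e0}"
    then have "c * e \<noteq> 0" using step.prems(1) by simp
    then show "?n * ?F (c * e) 1 = ?n ^ (2 * k - 1) - ?F (c * e) 0"
      using fibre_count_total[OF step.hyps(1), of "c * e" a] by (simp add: q_def)
  qed
  also have "\<dots> = (?n - 1) * ?n ^ (2 * k - 1) - ((\<Sum>e\<in>units. ?F (c * e) 0) - ?F (c * ?e0) 0)"
    using e0 card by (simp add: sum_subtractf sum.remove[of units ?e0])
  finally have rest: "?n * (\<Sum>e\<in>units - {?e0}. ?F (c * e) 1)
      = (?n - 1) * ?n ^ (2 * k - 1) - ((\<Sum>e\<in>units. ?F (c * e) 0) - ?F (c * ?e0) 0)"
    by (simp add: sum_distrib_left)
  have rec: "real (fibre_count (2 * Suc k) a c 0)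
      = q * ?F (c * ?e0) 0 + (?n - 1) * ?n ^ (2 * k - 1) - (\<Sum>e\<in>units. ?F (c * e) 0)"
    using fibre_count_rec[OF step.prems(1) ij] rest by (simp add: q_def algebra_simps)
  have IH: "q * ?F (c * ?e0) 0 = ?n ^ (2 * k - 1) + 1 - q ^ k
      + (if c * ?e0 * alt_prod {1..2 * k} a = (-1) ^ k then q ^ k * ?n else 0)"
  proof (rule step.IH)
    show "c * ?e0 \<noteq> 0" using step.prems(1) e0 by simp
    show "a i \<noteq> 0" if "i \<in> {1..2 * k}" for i using that by (intro nz) simp
  qed
  have iff: "c * ?e0 * alt_prod {1..2 * k} a = (-1) ^ k
      \<longleftrightarrow> c * alt_prod {1..2 * Suc k} a = (-1) ^ Suc k"
  proof -
    have "alt_prod {1..2 * Suc k} a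
        = alt_prod {1..2 * k} a * (a (2 * k + 1) * inverse (a (2 * k + 2)))"
      by (simp add: alt_prod_def mult.assoc)
    then have "c * alt_prod {1..2 * Suc k} a = - (c * ?e0 * alt_prod {1..2 * k} a)"
      by (simp add: field_simps)
    then show ?thesis by (simp only: power_Suc mult_minus1 neg_equal_iff_equal)
  qed
  have pw: "?n ^ (2 * Suc k - 1) = ?n * ?n * ?n ^ (2 * k - 1)" "?n ^ (2 * k) = ?n * ?n ^ (2 * k - 1)"
    using step.hyps(1) by (cases k; simp add: power_eq_if)+
  have "q * real (fibre_count (2 * Suc k) a c 0)
      = q * (q * ?F (c * ?e0) 0) + q * ((?n - 1) * ?n ^ (2 * k - 1)) - (?n ^ (2 * k) + ?n)"
    unfolding rec S[symmetric] by (simp add: algebra_simps)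
  also have "\<dots> = ?n ^ (2 * Suc k - 1) + 1 - q ^ Suc k
      + (if c * alt_prod {1..2 * Suc k} a = (-1) ^ Suc k then q ^ Suc k * ?n else 0)"
    unfolding IH iff pw by (simp add: algebra_simps)
  finally show ?case .
qed

section \<open>The edge code of a cycle as a space of linear forms\<close>

definition monom_value :: "(nat \<Rightarrow> 'a::comm_semiring_1) \<Rightarrow> (nat \<Rightarrow>\<^sub>0 nat) \<Rightarrow> 'a" where
  "monom_value P m = (\<Prod>i\<in>Poly_Mapping.keys m. P i ^ Poly_Mapping.lookup m i)"

text \<open>Evaluation sums over the keys of the polynomial, which shrink unpredictably under addition because
  of cancellation; a common larger finite set of monomials makes it additive.\<close>

lemma eval_mpoly_superset:
  assumes "finite M" "Poly_Mapping.keys f \<subseteq> M"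
  shows "eval_mpoly P f = (\<Sum>m\<in>M. Poly_Mapping.lookup f m * monom_value P m)"
  unfolding eval_mpoly_def monom_value_def
  by (rule sum.mono_neutral_left) (use assms in \<open>auto simp: in_keys_iff\<close>)

lemma eval_mpoly_add: "eval_mpoly P (f + g) = eval_mpoly P f + eval_mpoly P g"
proof -
  let ?M = "Poly_Mapping.keys f \<union> Poly_Mapping.keys g"
  have "eval_mpoly P (f + g) = (\<Sum>m\<in>?M. Poly_Mapping.lookup (f + g) m * monom_value P m)"
    using keys_add[of f g] by (intro eval_mpoly_superset) auto
  also have "\<dots> = eval_mpoly P f + eval_mpoly P g"
    by (simp add: eval_mpoly_superset[of ?M] lookup_add distrib_right sum.distrib)
  finally show ?thesis .
qed

lemma eval_mpoly_zero: "eval_mpoly P 0 = 0"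
  by (simp add: eval_mpoly_def)

lemma eval_mpoly_smult: "eval_mpoly P (smult_mpoly c f) = c * eval_mpoly P f"
proof -
  have eq: "smult_mpoly c f = Poly_Mapping.map ((*) c) f"
    by (simp add: smult_mpoly_def mult_map_scale_conv_mult)
  have lk: "Poly_Mapping.lookup (smult_mpoly c f) m = c * Poly_Mapping.lookup f m" for m
    unfolding eq by (simp add: Poly_Mapping.map.rep_eq when_def)
  have "eval_mpoly P (smult_mpoly c f)
      = (\<Sum>m\<in>Poly_Mapping.keys f. Poly_Mapping.lookup (smult_mpoly c f) m * monom_value P m)"
    by (intro eval_mpoly_superset) (auto simp: in_keys_iff lk)
  then show ?thesis
    by (simp add: lk eval_mpoly_superset[of "Poly_Mapping.keys f" f] sum_distrib_left mult.assoc)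
qed

lemma eval_mpoly_sum: "eval_mpoly P (\<Sum>i\<in>I. f i) = (\<Sum>i\<in>I. eval_mpoly P (f i))"
  by (induction I rule: infinite_finite_induct) (simp_all add: eval_mpoly_zero eval_mpoly_add)

lemma eval_mpoly_edge:
  assumes "i \<noteq> j"
  shows "eval_mpoly P (var i * var j :: 'a::field mpoly) = P i * P j"
proof -
  let ?m = "Poly_Mapping.single i 1 + Poly_Mapping.single j (1::nat)"
  have "Poly_Mapping.keys ?m = {i, j}"
    using assms by (auto simp: in_keys_iff lookup_add lookup_single when_def split: if_splits)
  then have "monom_value P ?m = P i * P j"
    using assms by (simp add: monom_value_def lookup_add lookup_single when_def)
  moreover have "var i * var j = (Poly_Mapping.single ?m 1 :: 'a mpoly)"
    by (simp add: var_def mult_single)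
  ultimately show ?thesis
    by (simp add: eval_mpoly_def monom_value_def)
qed

lemma cycle_edges_eq:
  assumes "s \<ge> 2"
  shows "cycle_edges s = (\<lambda>i. {i, nxt s i}) ` {1..s}"
proof -
  have "{1..s} = insert s {1..s - 1}" using assms by auto
  moreover have "(\<lambda>i. {i, nxt s i}) ` {1..s - 1} = (\<lambda>i. {i, i + 1}) ` {1..s - 1}"
    by (intro image_cong) (auto simp: nxt_def)
  moreover have "{s, nxt s s} = {1, s}" by (simp add: nxt_def insert_commute)
  ultimately show ?thesis by (simp only: cycle_edges_def image_insert) blast
qed

lemma nxt_neq: "s \<ge> 2 \<Longrightarrow> i \<noteq> nxt s i"
  by (simp add: nxt_def)

text \<open>The code sees a polynomial only through its values, so what is compared with a combination of the
  edge monomials is the value at every point, not the polynomial.\<close>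

lemma eval_edge_space:
  assumes "s \<ge> 2"
    and "f \<in> (edge_space (cycle_edges s) :: 'a::field mpoly set)"
  shows "\<exists>a. \<forall>P. eval_mpoly P f = (\<Sum>i\<in>{1..s}. a i * (P i * P (nxt s i)))"
  using assms(2) unfolding edge_space_def
proof (induction f rule: mpoly.span_induct_alt)
  case base
  have "\<forall>P. eval_mpoly P (0 :: 'a mpoly) = (\<Sum>i\<in>{1..s}. 0 * (P i * P (nxt s i)))"
    by (simp add: eval_mpoly_zero)
  then show ?case by (intro exI[of _ "\<lambda>_. 0"])
next
  case (step c x y)
  then obtain a where a: "\<And>P. eval_mpoly P y = (\<Sum>i\<in>{1..s}. a i * (P i * P (nxt s i)))"
    by blast
  from step obtain i j where x: "x = var i * var j" "{i, j} \<in> cycle_edges s" by blast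
  then obtain l where l: "l \<in> {1..s}" "{i, j} = {l, nxt s l}"
    unfolding cycle_edges_eq[OF assms(1)] by blast
  have "eval_mpoly P x = P l * P (nxt s l)" for P
  proof -
    have "x = var l * var (nxt s l)"
      using l(2) by (auto simp: x doubleton_eq_iff mult.commute)
    then show ?thesis using nxt_neq[OF assms(1), of l] eval_mpoly_edge by metis
  qed
  then have val: "eval_mpoly P (smult_mpoly c x + y)
      = c * (P l * P (nxt s l)) + (\<Sum>i\<in>{1..s}. a i * (P i * P (nxt s i)))" for P
    by (simp add: eval_mpoly_add eval_mpoly_smult a)
  have "eval_mpoly P (smult_mpoly c x + y)
      = (\<Sum>i\<in>{1..s}. (a(l := a l + c)) i * (P i * P (nxt s i)))" for P
  proof -
    have "(\<Sum>i\<in>{1..s}. (a(l := a l + c)) i * (P i * P (nxt s i)))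
        = (\<Sum>i\<in>{1..s}. (if i = l then c * (P i * P (nxt s i)) else 0) + a i * (P i * P (nxt s i)))"
      by (intro sum.cong) (auto simp: distrib_right add.commute)
    also have "\<dots> = eval_mpoly P (smult_mpoly c x + y)"
      unfolding val sum.distrib using l(1) by simp
    finally show ?thesis ..
  qed
  then show ?case by blast
qed

definition cycle_word :: "nat \<Rightarrow> (nat \<Rightarrow> 'a::field) \<Rightarrow> (nat \<Rightarrow> 'a) \<Rightarrow> 'a" where
  "cycle_word s a = (\<lambda>P\<in>torus s. \<Sum>i\<in>{1..s}. a i * edge_values s P i)"

lemma edge_code_cycle:
  assumes "s \<ge> 2"
  shows "(edge_code s (cycle_edges s) :: ((nat \<Rightarrow> 'a::field) \<Rightarrow> 'a) set)
    = cycle_word s ` ({1..s} \<rightarrow>\<^sub>E UNIV)" (is "?L = ?R")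
proof
  show "?L \<subseteq> ?R"
  proof
    fix c assume "c \<in> ?L"
    then obtain f :: "'a mpoly" where f: "f \<in> edge_space (cycle_edges s)"
      and c: "c = (\<lambda>P\<in>torus s. eval_mpoly P f)"
      by (auto simp: edge_code_def)
    obtain a where "\<And>P. eval_mpoly P f = (\<Sum>i\<in>{1..s}. a i * (P i * P (nxt s i)))"
      using eval_edge_space[OF assms f] by blast
    then have "c = cycle_word s (restrict a {1..s})"
      by (simp add: c cycle_word_def edge_values_def)
    then show "c \<in> ?R" using image_eqI[of c "cycle_word s" "restrict a {1..s}"] by simp
  qed
  show "?R \<subseteq> ?L"
  proof (rule image_subsetI)
    fix a :: "nat \<Rightarrow> 'a"
    let ?f = "\<Sum>i\<in>{1..s}. smult_mpoly (a i) (var i * var (nxt s i))"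
    have "var i * var (nxt s i) \<in> {var i * var j :: 'a mpoly | i j. {i, j} \<in> cycle_edges s}"
      if "i \<in> {1..s}" for i
    proof -
      have "{i, nxt s i} \<in> cycle_edges s" using that by (simp add: cycle_edges_eq[OF assms])
      then show ?thesis by blast
    qed
    then have "?f \<in> edge_space (cycle_edges s)"
      unfolding edge_space_def by (intro mpoly.span_sum mpoly.span_scale mpoly.span_base)
    moreover have "cycle_word s a = (\<lambda>P\<in>torus s. eval_mpoly P ?f)"
      using nxt_neq[OF assms]
      by (simp add: cycle_word_def edge_values_def eval_mpoly_sum eval_mpoly_smult eval_mpoly_edge)
    ultimately show "cycle_word s a \<in> ?L"
      unfolding edge_code_def by (intro image_eqI)
  qed
qed

section \<open>Two exponential Diophantine equations\<close>

text \<open>The exponent \<open>m = 1\<close> would force \<open>k = 1\<close>. For odd \<open>n\<close> the equation fails modulo \<open>2 * (n + 1)\<close>, and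
  for even \<open>n\<close> and odd \<open>k\<close> it fails modulo \<open>2 * n\<close>. For \<open>k = 2 * l\<close> and \<open>x = (n + 1) ^ l\<close> it reads
  \<open>(x - 1) * (x + 1) = n ^ m\<close>. Since \<open>n = 2 * n'\<close> divides \<open>x - 1\<close>, the half of \<open>x + 1\<close> is coprime
  to \<open>n'\<close> and so divides a power of two, while \<open>n' ^ m\<close> divides \<open>2 * (x - 1)\<close>. Comparing sizes
  leaves only \<open>n' \<le> 2\<close>. Then \<open>x + 1\<close>, up to a factor \<open>2\<close> or \<open>4\<close>, is an odd divisor of a power of
  two, which rules out \<open>n' = 2\<close> and all \<open>l > 1\<close>.\<close>

lemma succ_power_eq_power_plus_1:
  fixes n m k :: nat
  assumes "n \<ge> 2" "k \<ge> 2" "odd m" "n ^ m + 1 = (n + 1) ^ k"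
  shows "n = 2 \<and> k = 2 \<and> m = 3"
proof -
  have m1: "m \<noteq> 1"
  proof
    assume "m = 1"
    then have "(n + 1) ^ 1 = (n + 1) ^ k" using assms by simp
    then have "k = 1" using assms(1) power_inject_exp[of "n + 1" 1 k] by simp
    then show False using assms by simp
  qed
  then have m3: "m \<ge> 3" using assms(3) by (cases m; auto; presburger)
  have eqi: "int n ^ m + 1 = (int n + 1) ^ k"
    using arg_cong[OF assms(4), of int] by (simp add: add.commute)
  have pd: "x - 1 dvd x ^ j - 1" for x :: int and j
    by (simp add: power_diff_1_eq)
  \<comment> \<open>For odd \<open>n\<close>, both \<open>n ^ 2 - 1\<close> and \<open>(n + 1) ^ 2\<close> vanish modulo \<open>2 * (n + 1)\<close>, but \<open>n + 1\<close> does not.\<close>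
  have even_n: "even n"
  proof (rule ccontr)
    assume "odd n"
    then have "2 * (int n + 1) dvd (int n - 1) * (int n + 1)"
      by (intro mult_dvd_mono) auto
    then have "2 * (int n + 1) dvd (int n)\<^sup>2 - 1"
      by (simp add: algebra_simps power2_eq_square)
    then have "2 * (int n + 1) dvd ((int n)\<^sup>2) ^ (m div 2) - 1"
      using pd dvd_trans by blast
    then have "2 * (int n + 1) dvd int n * (((int n)\<^sup>2) ^ (m div 2) - 1)" by simp
    also have "\<dots> = int n ^ m - int n"
      using odd_two_times_div_two_succ[OF assms(3)]
      by (metis (no_types, lifting) Suc_eq_plus1 mult.right_neutral power_Suc power_mult right_diff_distrib)
    finally have 1: "2 * (int n + 1) dvd int n ^ m - int n" .
    have "2 * (int n + 1) dvd (int n + 1) * (int n + 1)"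
      using \<open>odd n\<close> by (intro mult_dvd_mono) auto
    also have "\<dots> = (int n + 1) ^ 2" by (simp add: power2_eq_square)
    also have "\<dots> dvd (int n + 1) ^ k" using assms by (intro le_imp_power_dvd)
    finally have "2 * (int n + 1) dvd int n ^ m + 1" using eqi by simp
    from dvd_diff[OF this 1] have "2 * (int n + 1) dvd int n + 1" by (simp add: add.commute)
    then show False using zdvd_imp_le[of "2 * (int n + 1)" "int n + 1"] by simp
  qed
  \<comment> \<open>For odd \<open>k\<close>, both \<open>(n + 1) ^ 2 - 1\<close> and \<open>n ^ 2\<close> vanish modulo \<open>2 * n\<close>, but \<open>n\<close> does not.\<close>
  have "even k"
  proof (rule ccontr)
    assume "odd k"
    have "2 * int n dvd (int n + 2) * int n"
      using even_n by (intro mult_dvd_mono) auto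
    then have "2 * int n dvd (int n + 1)\<^sup>2 - 1"
      by (simp add: algebra_simps power2_eq_square)
    then have "2 * int n dvd ((int n + 1)\<^sup>2) ^ (k div 2) - 1"
      using pd dvd_trans by blast
    then have "2 * int n dvd (int n + 1) * (((int n + 1)\<^sup>2) ^ (k div 2) - 1)" by simp
    also have "\<dots> = (int n + 1) ^ k - (int n + 1)"
      using odd_two_times_div_two_succ[OF \<open>odd k\<close>]
      by (metis (no_types, lifting) Suc_eq_plus1 mult.right_neutral power_Suc power_mult right_diff_distrib)
    also have "\<dots> = int n ^ m - int n" using eqi by simp
    finally have 1: "2 * int n dvd int n ^ m - int n" .
    have "2 * int n dvd int n * int n" using even_n by (intro mult_dvd_mono) auto
    also have "\<dots> = int n ^ 2" by (simp add: power2_eq_square)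
    also have "\<dots> dvd int n ^ m" using m3 by (intro le_imp_power_dvd) simp
    finally have "2 * int n dvd int n ^ m" .
    from dvd_diff[OF this 1] have "2 * int n dvd int n" by simp
    then show False using zdvd_imp_le[of "2 * int n" "int n"] assms(1) by simp
  qed
  then obtain l where l: "k = 2 * l" by auto
  obtain n' where n': "n = 2 * n'" using even_n by auto
  define x where "x = int (n + 1) ^ l"
  have "int n dvd x - 1" unfolding x_def using pd[of "int (n + 1)" l] by simp
  then obtain t where t: "x - 1 = int n * t" by auto
  define u where "u = 1 + int n' * t"
  have x1: "x > 1" unfolding x_def using assms l by (intro one_less_power) auto
  have xu: "x + 1 = 2 * u" using t n' by (simp add: u_def algebra_simps)
  have "(x - 1) * (x + 1) = int n ^ m"
    using eqi l by (simp add: x_def algebra_simps power_mult power2_eq_square flip: power_mult_distrib)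
  then have prod: "(x - 1) * (2 * u) = 2 ^ m * int n' ^ m"
    unfolding xu n' by (simp add: power_mult_distrib)
  have cop: "coprime u (int n' ^ m)"
    unfolding u_def by (simp add: coprime_commute) (metis add.commute coprime_1_left coprime_commute gcd_add_mult coprime_iff_gcd_eq_1 mult.commute)
  have "2 * ((x - 1) * u) = 2 * (2 ^ (m - 1) * int n' ^ m)"
    using prod m3 power_minus_mult[of m "2::int"] by (simp add: algebra_simps)
  then have "u dvd 2 ^ (m - 1) * int n' ^ m" by (metis dvd_triv_right mult_left_cancel zero_neq_numeral)
  then have u2: "u dvd 2 ^ (m - 1)" using cop coprime_dvd_mult_left_iff by blast
  have "2 * u \<le> 2 * 2 ^ (m - 1)" using zdvd_imp_le[OF u2] by simp
  then have ule: "2 * u \<le> 2 ^ m" using m3 power_minus_mult[of m "2::int"] by simp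
  have "int n' ^ m dvd 2 * (x - 1) * u" using prod by (metis dvd_triv_right mult.assoc mult.commute)
  then have "int n' ^ m dvd 2 * (x - 1)" using cop by (simp add: coprime_dvd_mult_left_iff coprime_commute)
  then have "int n' ^ m \<le> 2 * (x - 1)" using x1 by (intro zdvd_imp_le) auto
  then have small: "int n' ^ m < 2 * 2 ^ m" using ule xu by simp
  have "n' \<le> 2"
  proof (rule ccontr)
    assume "\<not> n' \<le> 2"
    then have "(3::int) ^ m \<le> int n' ^ m" by (intro power_mono) auto
    moreover have "2 * 2 ^ m \<le> (3::int) ^ m" using m3
    proof (induction m rule: dec_induct)
      case (step j)
      show ?case
        unfolding power_Suc using step.IH zero_le_power[of "2::int" j] by linarith
    qed simp
    ultimately show False using small by simp
  qed
  have odd_div_2: "v = 1" if "odd v" "v dvd 2 ^ j" "v > 0" for v :: int and j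
  proof -
    have "coprime v (2 ^ j)" using that by simp
    then have "v dvd 1" using that(2) by (metis coprime_common_divisor dvd_refl)
    then show ?thesis using that(3) by auto
  qed
  have "n' \<noteq> 2"
  proof
    assume "n' = 2"
    then have "odd u" by (simp add: u_def)
    then have "u = 1" using odd_div_2[OF _ u2] x1 xu by simp
    then show False using x1 xu by simp
  qed
  then have n2: "n = 2" using \<open>n' \<le> 2\<close> n' assms(1) by simp
  have x3: "x = 3 ^ l" by (simp add: x_def n2)
  have "(x - 1) * (x + 1) = 2 ^ m" using prod n' n2 xu by simp
  then have div: "x + 1 dvd 2 ^ m" by (metis dvd_triv_right)
  have "l = 1"
  proof (cases "even l")
    case True
    then obtain h where h: "l = 2 * h" by auto
    have "x mod 4 = 1" unfolding x3 h power_mult by (simp add: power_mod[symmetric, of 9 4 h, simplified] flip: power_mod)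
    then have "odd u" using xu by presburger
    then have "u = 1" using odd_div_2[OF _ u2] x1 xu by simp
    then show ?thesis using x1 xu by simp
  next
    case False
    then obtain h where h: "l = 2 * h + 1" by (elim oddE)
    have "(9::int) ^ h mod 8 = 1" using power_mod[of "9::int" 8 h] by simp
    then have "x mod 8 = 3" unfolding x3 h by (simp add: power_mult power_add) presburger
    then have "x + 1 = 4 * ((x + 1) div 4)" "odd ((x + 1) div 4)" by presburger+
    then obtain v where v: "x + 1 = 4 * v" "odd v" by blast
    have "v dvd 2 ^ m" using div v(1) dvd_trans dvd_triv_right by metis
    then have "v = 1" using odd_div_2 v x1 by simp
    then have "(3::int) ^ l = 3 ^ 1" using v x3 by simp
    then show ?thesis by (subst (asm) power_inject_exp) auto
  qed
  then have "k = 2" using l by simp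
  then have "2 ^ m = (2::nat) ^ 3" using assms(4) n2 by simp
  then have "m = 3" by (subst (asm) power_inject_exp) auto
  with n2 \<open>k = 2\<close> show ?thesis by simp
qed

text \<open>An equality would factor as \<open>(n + 1) ^ k = B * (n ^ h + 1)\<close> with \<open>B = 1 + n + \<dots> + n ^ (h - 1)\<close>.
  Modulo \<open>n + 1\<close>, the powers of \<open>n\<close> alternate between \<open>1\<close> and \<open>-1\<close>. If \<open>h\<close> is odd, \<open>B\<close> is
  therefore \<open>1\<close> modulo \<open>n + 1\<close>, hence coprime to \<open>n + 1\<close>, hence \<open>1\<close>; then \<open>h = 1\<close> and \<open>k = 1\<close>. If
  \<open>h\<close> is even, \<open>n ^ h + 1\<close> is \<open>2\<close> modulo \<open>n + 1\<close>. For even \<open>n\<close> it is then coprime to \<open>n + 1\<close>; for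
  odd \<open>n\<close> its half is, because the half is odd. A divisor of \<open>(n + 1) ^ k\<close> that is coprime to
  \<open>n + 1\<close> is \<open>1\<close>, which is too small.\<close>

lemma mult_succ_power_plus_1_neq_even_power:
  fixes n h k :: nat
  assumes "n \<ge> 2" "k \<ge> 2"
  shows "1 + (int n - 1) * (int n + 1) ^ k \<noteq> int n ^ (2 * h)"
proof
  assume eq: "1 + (int n - 1) * (int n + 1) ^ k = int n ^ (2 * h)"
  define N where "N = int n"
  have N: "N \<ge> 2" using assms by (simp add: N_def)
  define B where "B = (\<Sum>j<h. N ^ j)"
  have B: "(N - 1) * B = N ^ h - 1" by (simp add: B_def power_diff_1_eq)
  have "(N - 1) * (N + 1) ^ k = (N ^ h - 1) * (N ^ h + 1)"
    using eq unfolding mult_2 power_add by (simp add: N_def algebra_simps)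
  also have "\<dots> = (N - 1) * (B * (N ^ h + 1))" by (simp add: B[symmetric])
  finally have fac: "(N + 1) ^ k = B * (N ^ h + 1)" using N by simp
  have unit: "v = 1" if "coprime v (N + 1)" "v dvd (N + 1) ^ k" "v > 0" for v
  proof -
    have "coprime v ((N + 1) ^ k)" using that(1) by simp
    then have "v dvd 1" using that(2) by (metis coprime_common_divisor dvd_refl)
    then show ?thesis using that(3) by auto
  qed
  have pd: "(N - 1) * (N + 1) dvd N ^ (2 * j) - 1" for j
  proof -
    have "N\<^sup>2 - 1 dvd (N\<^sup>2) ^ j - 1" by (simp add: power_diff_1_eq)
    then show ?thesis by (simp add: power_mult algebra_simps power2_eq_square)
  qed
  have "h \<noteq> 0"
  proof
    assume "h = 0"
    then have "(N + 1) ^ k = 0" using fac by (simp add: B_def)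
    then show False using N by simp
  qed
  show False
  proof (cases "even h")
    case True
    then obtain j where "h = 2 * j" by auto
    then have "N + 1 dvd N ^ h - 1" using pd[of j] dvd_mult_right by blast
    then have two: "d dvd 2" if "d dvd N ^ h + 1" "d dvd N + 1" for d
      using that dvd_diff[of d "N ^ h + 1" "N ^ h - 1"] dvd_trans by fastforce
    show False
    proof (cases "even N")
      case True
      have "coprime (N ^ h + 1) (N + 1)"
      proof (rule coprimeI)
        fix d assume d: "d dvd N ^ h + 1" "d dvd N + 1"
        have "coprime 2 (N + 1)" using True by simp
        then show "is_unit d" using two[OF d] d(2) coprime_common_divisor by blast
      qed
      then have "N ^ h + 1 = 1" by (rule unit) (use fac N in auto)
      then show False using N by simp
    next
      case False
      obtain i where i: "N = 2 * i + 1" using False by (elim oddE)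
      have "4 dvd N\<^sup>2 - 1" by (simp add: i power2_eq_square algebra_simps)
      also have "\<dots> dvd (N\<^sup>2) ^ j - 1" by (simp add: power_diff_1_eq)
      finally obtain w where w: "N ^ h - 1 = 4 * w"
        unfolding \<open>h = 2 * j\<close> power_mult by (elim dvdE)
      define u where "u = 2 * w + 1"
      have u: "N ^ h + 1 = 2 * u" "odd u" using w by (simp_all add: u_def)
      have "coprime u (N + 1)"
      proof (rule coprimeI)
        fix d assume d: "d dvd u" "d dvd N + 1"
        have "d dvd 2" using two[OF _ d(2)] d(1) u(1) by simp
        moreover have "coprime 2 u" using u(2) by simp
        ultimately show "is_unit d" using d(1) coprime_common_divisor by blast
      qed
      moreover have "N ^ h \<ge> 1" using N by simp
      ultimately have "u = 1" using u fac by (intro unit) auto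
      then have "N ^ h = 1" using u by simp
      then show False using one_less_power[of N h] \<open>h \<noteq> 0\<close> N by simp
    qed
  next
    case False
    then obtain j where j: "h = 2 * j + 1" by (elim oddE)
    have "(N - 1) * (B - 1) = N * (N ^ (2 * j) - 1)"
      using B j by (simp add: algebra_simps)
    moreover have "(N - 1) * (N + 1) dvd N * (N ^ (2 * j) - 1)" using pd[of j] by simp
    ultimately have "(N - 1) * (N + 1) dvd (N - 1) * (B - 1)" by simp
    then have NB: "N + 1 dvd B - 1" using N by simp
    have "coprime B (N + 1)"
    proof (rule coprimeI)
      fix d assume "d dvd B" "d dvd N + 1"
      then have "d dvd B - (B - 1)" using NB dvd_trans dvd_diff by blast
      then show "is_unit d" by simp
    qed
    moreover have "B > 0" unfolding B_def using N \<open>h \<noteq> 0\<close> by (intro sum_pos) auto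
    ultimately have "B = 1" using fac by (intro unit) auto
    then have "N ^ h = N ^ 1" using B by simp
    then have "h = 1" using N by (subst (asm) power_inject_exp) auto
    then have "(N + 1) ^ k = (N + 1) ^ 1" using fac \<open>B = 1\<close> by simp
    then have "k = 1" using N by (subst (asm) power_inject_exp) auto
    then show False using assms by simp
  qed
qed

section \<open>Comparison of the closed forms of the weights\<close>

text \<open>The weight of a word whose coefficient vector has \<open>r < s\<close> non-zero entries, as a closed form of
  the alternating sum. It vanishes for \<open>r = 0\<close>, so the zero word obeys the same formula.\<close>

definition partial_weight :: "nat \<Rightarrow> nat \<Rightarrow> nat \<Rightarrow> real" where
  "partial_weight q s r
    = ((real q - 1) ^ (s + 1) - (-1) ^ r * (real q - 1) ^ (s - r + 1)) / real q"

text \<open>The weight of a word whose coefficient vector has no zero entry; \<open>b\<close> states whether the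
  alternating product of the coefficients is \<open>(-1) ^ k\<close>.\<close>

definition full_weight :: "nat \<Rightarrow> nat \<Rightarrow> bool \<Rightarrow> real" where
  "full_weight q k b
    = ((real q - 1) ^ (2 * k + 1) - (real q - 1) + (real q - 1) * real q ^ k
        - (if b then (real q - 1) ^ 2 * real q ^ k else 0)) / real q"

lemma partial_weight_eq_sum:
  assumes "q > 0" "r \<le> s"
  shows "partial_weight q s r = (\<Sum>i<r. (-1) ^ i * (real q - 1) ^ (s - i))"
proof -
  have "real q * (\<Sum>i<r. (-1) ^ i * (real q - 1) ^ (s - i))
      = (real q - 1) ^ (s + 1) - (-1) ^ r * (real q - 1) ^ (s - r + 1)"
    using assms(2)
  proof (induction r)
    case (Suc r)
    then have "s - r = Suc (s - Suc r)" by simp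
    then show ?case using Suc by (simp add: algebra_simps)
  qed simp
  then show ?thesis using assms(1) by (simp add: partial_weight_def field_simps)
qed

text \<open>Apart from a sign, \<open>r\<close> enters the closed form only as an exponent of \<open>q - 1 \<ge> 2\<close>.\<close>

lemma partial_weight_inj:
  assumes "q > 2" "r \<le> s" "r' \<le> s" "partial_weight q s r = partial_weight q s r'"
  shows "r = r'"
proof -
  have "(-1) ^ r * (real q - 1) ^ (s - r + 1) = (-1) ^ r' * (real q - 1) ^ (s - r' + 1)"
    using assms by (simp add: partial_weight_def)
  then have "\<bar>(-1) ^ r * (real q - 1) ^ (s - r + 1)\<bar> = \<bar>(-1) ^ r' * (real q - 1) ^ (s - r' + 1)\<bar>"
    by (simp only:)
  then have "(real q - 1) ^ (s - r + 1) = (real q - 1) ^ (s - r' + 1)"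
    using assms(1) by (simp add: abs_mult power_abs)
  then have "s - r + 1 = s - r' + 1"
    using assms(1) by (subst (asm) power_inject_exp) auto
  then show ?thesis using assms by simp
qed

text \<open>Comparing signs forces \<open>r\<close> to be even, which leads to \<open>mult_succ_power_plus_1_neq_even_power\<close> with
  \<open>n = q - 1\<close>.\<close>

lemma partial_neq_full_special:
  assumes "q > 2" "k \<ge> 2" "r < 2 * k"
  shows "partial_weight q (2 * k) r \<noteq> full_weight q k True"
proof
  assume eq: "partial_weight q (2 * k) r = full_weight q k True"
  let ?n = "real q - 1"
  have "?n * ((-1) ^ r * ?n ^ (2 * k - r)) = ?n * (1 + (?n - 1) * (?n + 1) ^ k)"
    using eq assms(1) by (simp add: partial_weight_def full_weight_def power2_eq_square algebra_simps)
  then have rel: "(-1) ^ r * ?n ^ (2 * k - r) = 1 + (?n - 1) * (?n + 1) ^ k"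
    using assms(1) by simp
  have "1 + (?n - 1) * (?n + 1) ^ k > 0"
    using assms(1) by (intro add_pos_nonneg mult_nonneg_nonneg) auto
  moreover have "0 \<le> ?n ^ (2 * k - r)" using assms(1) by simp
  ultimately have "even r"
    using rel by (cases "even r") auto
  then have "even (2 * k - r)" by simp
  then obtain h where h: "2 * k - r = 2 * h" by (elim evenE)
  define n where "n = q - 1"
  have n: "?n = real_of_int (int n)" "n \<ge> 2" using assms(1) by (simp_all add: n_def of_nat_diff)
  have "real_of_int (int n ^ (2 * h)) = real_of_int (1 + (int n - 1) * (int n + 1) ^ k)"
    using rel \<open>even r\<close> h unfolding n by simp
  then show False using mult_succ_power_plus_1_neq_even_power[OF n(2) assms(2), of h] by (metis of_int_eq_iff)
qed

text \<open>Comparing signs forces \<open>r\<close> to be odd; then \<open>2 * k - r\<close> is odd as well, and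
  \<open>succ_power_eq_power_plus_1\<close> applies.\<close>

lemma partial_eq_full_generic:
  assumes "q > 2" "k \<ge> 2" "r < 2 * k" "partial_weight q (2 * k) r = full_weight q k False"
  shows "q = 3 \<and> k = 2 \<and> r = 1"
proof -
  let ?n = "real q - 1"
  have "?n * (- ((-1) ^ r * ?n ^ (2 * k - r))) = ?n * (real q ^ k - 1)"
    using assms by (simp add: partial_weight_def full_weight_def algebra_simps)
  moreover have "?n \<noteq> 0" using assms(1) by simp
  ultimately have rel: "- ((-1) ^ r * ?n ^ (2 * k - r)) = real q ^ k - 1"
    by (simp only: mult_left_cancel not_False_eq_True)
  have "real q ^ k > 1" using assms by (intro one_less_power) auto
  moreover have "0 \<le> ?n ^ (2 * k - r)" using assms(1) by simp
  ultimately have r: "odd r"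
    using rel by (cases "even r") auto
  define n where "n = q - 1"
  have n: "?n = real n" "n \<ge> 2" "q = n + 1" using assms(1) by (simp_all add: n_def of_nat_diff)
  have "real (n ^ (2 * k - r) + 1) = real ((n + 1) ^ k)"
    using rel r unfolding n(1) n(3) by simp
  then have "n ^ (2 * k - r) + 1 = (n + 1) ^ k" by (simp only: of_nat_eq_iff)
  moreover have "odd (2 * k - r)" using r assms(3) by simp
  ultimately have "n = 2 \<and> k = 2 \<and> 2 * k - r = 3"
    using succ_power_eq_power_plus_1 n(2) assms(2) by blast
  then show ?thesis using n(3) assms(3) by auto
qed

lemma full_weight_inj:
  assumes "q > 2" "full_weight q k b = full_weight q k b'"
  shows "b = b'"
  using assms by (auto simp: full_weight_def split: if_splits)

lemma partial_weight_ge: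
  assumes "q > 2" "1 \<le> r" "r \<le> s" "s \<ge> 2"
  shows "partial_weight q s 2 \<le> partial_weight q s r"
proof -
  let ?n = "real q - 1"
  have "(-1) ^ r * ?n ^ (s - r + 1) \<le> ?n ^ (s - 2 + 1)"
  proof (cases "even r")
    case True
    then have "r \<ge> 2" using assms(2) by (cases "r = 1") auto
    then show ?thesis using True assms by (auto intro!: power_increasing)
  next
    case False
    then have "(-1) ^ r * ?n ^ (s - r + 1) \<le> 0" using assms(1) by simp
    also have "0 \<le> ?n ^ (s - 2 + 1)" using assms(1) by simp
    finally show ?thesis .
  qed
  then show ?thesis using assms(1) by (simp add: partial_weight_def divide_right_mono)
qed

lemma full_weight_ge:
  assumes "q > 2" "k \<ge> 1"
  shows "partial_weight q (2 * k) 2 \<le> full_weight q k False"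
    and "full_weight q k True \<le> full_weight q k False"
    and "full_weight q k True \<le> partial_weight q (2 * k) 2
      \<longleftrightarrow> (real q - 1) ^ (2 * k - 2) \<le> real q ^ k * (real q - 2) + 1"
proof -
  let ?n = "real q - 1"
  have pw: "?n ^ (2 * k - 2 + 1) = ?n * ?n ^ (2 * k - 2)" by simp
  have "1 \<le> real q ^ k" using assms by (intro one_le_power) auto
  then have "?n * 1 \<le> ?n * real q ^ k" using assms by (intro mult_left_mono) auto
  moreover have "0 \<le> ?n ^ (2 * k - 2 + 1)" using assms by simp
  moreover have "z - y \<le> z - u + v" if "u * 1 \<le> v" "0 \<le> y" for u v y z :: real
    using that by simp
  ultimately have "?n ^ (2 * k + 1) - ?n ^ (2 * k - 2 + 1) \<le> ?n ^ (2 * k + 1) - ?n + ?n * real q ^ k"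
    by blast
  then show "partial_weight q (2 * k) 2 \<le> full_weight q k False"
    using assms(1) by (simp add: partial_weight_def full_weight_def divide_right_mono)
  show "full_weight q k True \<le> full_weight q k False"
    using assms(1) by (simp add: full_weight_def divide_right_mono)
  have "u - n + n * K - n\<^sup>2 * K - (u - n * Y) = n * (Y - (K * (n - 1) + 1))" for u n K Y :: real
    by (simp add: algebra_simps power2_eq_square)
  moreover have "full_weight q k True
      = (?n ^ (2 * k + 1) - ?n + ?n * real q ^ k - ?n\<^sup>2 * real q ^ k) / real q"
    by (simp add: full_weight_def)
  moreover have "partial_weight q (2 * k) 2 = (?n ^ (2 * k + 1) - ?n * ?n ^ (2 * k - 2)) / real q"
    by (simp add: partial_weight_def)
  moreover have "real q - 2 = ?n - 1" by simp
  ultimately have "full_weight q k True - partial_weight q (2 * k) 2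
      = ?n * (?n ^ (2 * k - 2) - (real q ^ k * (real q - 2) + 1)) / real q"
    by (simp only: diff_divide_distrib[symmetric])
  moreover have "?n > 0" using assms(1) by simp
  ultimately have "full_weight q k True - partial_weight q (2 * k) 2 \<le> 0
      \<longleftrightarrow> ?n ^ (2 * k - 2) - (real q ^ k * (real q - 2) + 1) \<le> 0"
    using assms(1) by (simp only: divide_le_0_iff mult_le_0_iff) auto
  then show "full_weight q k True \<le> partial_weight q (2 * k) 2
      \<longleftrightarrow> ?n ^ (2 * k - 2) \<le> real q ^ k * (real q - 2) + 1"
    by (simp only: diff_le_0_iff_le)
qed

lemma full_weight_True_eq:
  assumes "q > 2" "k \<ge> 2"
  shows "full_weight q k True = (real q - 1) ^ (2 * k)
          - real q ^ (k - 2) * ((real q - 1) ^ 3 + (real q - 1) ^ 2 * (real q - 2))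
          - ((real q - 1) ^ (2 * k) - (real q - 1) * (real q ^ (k - 2) - 1)
               - real q ^ (k - 2) * (real q - 1) ^ 4) / real q"
proof -
  have "real q ^ k = real q ^ 2 * real q ^ (k - 2)"
    using power_add[of "real q" 2 "k - 2"] assms(2) by (simp only: le_add_diff_inverse)
  moreover have "((x - 1) * X - (x - 1) + (x - 1) * (x ^ 2 * K) - (x - 1) ^ 2 * (x ^ 2 * K)) / x
      = X - K * ((x - 1) ^ 3 + (x - 1) ^ 2 * (x - 2)) - (X - (x - 1) * (K - 1) - K * (x - 1) ^ 4) / x"
    if "x \<noteq> 0" for x X K :: real
  proof -
    have "(x - 1) * X - (x - 1) + (x - 1) * (x ^ 2 * K) - (x - 1) ^ 2 * (x ^ 2 * K)
        = x * (X - K * ((x - 1) ^ 3 + (x - 1) ^ 2 * (x - 2))) - (X - (x - 1) * (K - 1) - K * (x - 1) ^ 4)"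
      by algebra
    then show ?thesis
      using that by (simp only: diff_divide_distrib[of "x * _"] nonzero_mult_div_cancel_left
          not_False_eq_True)
  qed
  ultimately show ?thesis using assms(1) by (simp add: full_weight_def)
qed

lemma full_weight_False_eq:
  assumes "q > 2" "k \<ge> 2"
  shows "full_weight q k False = (real q - 1) ^ (2 * k)
          - real q ^ (k - 2) * (real q - 1) ^ 2 * (real q - 3)
          - ((real q - 1) ^ (2 * k) - (real q - 1) * (real q ^ (k - 2) - 1)
               - real q ^ (k - 2) * (real q - 1) ^ 4) / real q"
proof -
  have "real q ^ k = real q ^ 2 * real q ^ (k - 2)"
    using power_add[of "real q" 2 "k - 2"] assms(2) by (simp only: le_add_diff_inverse)
  moreover have "((x - 1) * X - (x - 1) + (x - 1) * (x ^ 2 * K) - 0) / x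
      = X - K * (x - 1) ^ 2 * (x - 3) - (X - (x - 1) * (K - 1) - K * (x - 1) ^ 4) / x"
    if "x \<noteq> 0" for x X K :: real
  proof -
    have "(x - 1) * X - (x - 1) + (x - 1) * (x ^ 2 * K) - 0
        = x * (X - K * (x - 1) ^ 2 * (x - 3)) - (X - (x - 1) * (K - 1) - K * (x - 1) ^ 4)"
      by algebra
    then show ?thesis
      using that by (simp only: diff_divide_distrib[of "x * _"] nonzero_mult_div_cancel_left
          not_False_eq_True)
  qed
  ultimately show ?thesis using assms(1) by (simp add: full_weight_def)
qed

lemma full_weight_True_eq_powi:
  assumes "q > 2" "k \<ge> 2"
  shows "full_weight q k True = (real q - 1) ^ (2 * k)
          - real q ^ (k - 2) * ((real q - 1) ^ 3 + (real q - 1) ^ 2 * (real q - 2))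
          - ((real q - 1) ^ (2 * k) - (real q - 1) * (real q ^ (k - 2) - 1)) / real q
          + real q powi (int k - 3) * (real q - 1) ^ 4"
proof -
  define j where "j = k - 2"
  have k: "int k - 3 = int j - 1" using assms(2) by (simp add: j_def)
  have "real q powi (int j - 1) = real q ^ j / real q"
    using assms(1) power_int_diff[of "real q" "int j" 1] by simp
  then have "real q powi (int k - 3) = real q ^ (k - 2) / real q"
    unfolding k j_def .
  then show ?thesis
    unfolding full_weight_True_eq[OF assms] by (simp add: diff_divide_distrib)
qed

lemma partial_weight_2:
  assumes "q > 0" "s \<ge> 2"
  shows "partial_weight q s 2 = (real q - 1) ^ (s - 1) * (real q - 2)"
proof -
  obtain j where "s = j + 2" using assms(2) by (metis add.commute le_iff_add)
  moreover have "x ^ (j + 2 + 1) - x ^ (j + 1) = (x + 1) * (x ^ (j + 1) * (x - 1))" for x :: real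
    by (simp add: power_add algebra_simps power2_eq_square)
  from this[of "real q - 1"]
  have "(real q - 1) ^ (j + 2 + 1) - (real q - 1) ^ (j + 1)
      = real q * ((real q - 1) ^ (j + 1) * (real q - 2))" by simp
  ultimately show ?thesis using assms(1)
    by (simp add: partial_weight_def)
qed

section \<open>Weights of the codewords\<close>

text \<open>Induction on the index set with Pascal's rule, according to whether the new entry is zero.\<close>

lemma card_support_eq:
  assumes "finite J"
  shows "card {a \<in> J \<rightarrow>\<^sub>E (UNIV :: 'a::{zero,finite} set). card {i \<in> J. a i \<noteq> 0} = r}
    = (card J choose r) * (CARD('a) - 1) ^ r"
  using assms
proof (induction J arbitrary: r)
  case empty
  then show ?case by (cases r) auto
next
  case (insert i J)
  let ?B = "\<lambda>r. {a \<in> J \<rightarrow>\<^sub>E (UNIV :: 'a set). card {l \<in> J. a l \<noteq> 0} = r}"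
  have supp: "card {l \<in> insert i J. (z(i := x)) l \<noteq> 0}
      = (if x = 0 then card {l \<in> J. z l \<noteq> 0} else Suc (card {l \<in> J. z l \<noteq> 0}))"
    for x :: 'a and z
  proof (cases "x = 0")
    case True
    then have "{l \<in> insert i J. (z(i := x)) l \<noteq> 0} = {l \<in> J. z l \<noteq> 0}"
      using insert.hyps by auto
    then show ?thesis using True by simp
  next
    case False
    then have "{l \<in> insert i J. (z(i := x)) l \<noteq> 0} = insert i {l \<in> J. z l \<noteq> 0}"
      using insert.hyps by auto
    then show ?thesis using False insert.hyps by simp
  qed
  have "card {a \<in> insert i J \<rightarrow>\<^sub>E (UNIV :: 'a set). card {l \<in> insert i J. a l \<noteq> 0} = r}
      = (\<Sum>x\<in>(UNIV :: 'a set). card {z \<in> J \<rightarrow>\<^sub>E (UNIV :: 'a set).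
          (if x = 0 then card {l \<in> J. z l \<noteq> 0} else Suc (card {l \<in> J. z l \<noteq> 0})) = r})"
    by (simp only: card_PiE_insert_filter[OF insert.hyps(1) finite insert.hyps(2)] supp)
  also have "\<dots> = card (?B r) + (\<Sum>x\<in>(units :: 'a set).
      card {z \<in> J \<rightarrow>\<^sub>E (UNIV :: 'a set). Suc (card {l \<in> J. z l \<noteq> 0}) = r})"
    by (subst sum.remove[of _ 0]) auto
  also have "\<dots> = (card (insert i J) choose r) * (CARD('a) - 1) ^ r"
  proof (cases r)
    case 0
    then show ?thesis using insert.IH[of 0] by simp
  next
    case (Suc r')
    then show ?thesis
      using insert.IH[of r'] insert.IH[of r] insert.hyps
      by (simp add: card_Diff_singleton algebra_simps)
  qed
  finally show ?case .
qed

lemma hamming_weight_cycle_word: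
  fixes a :: "nat \<Rightarrow> 'a::{field,finite}"
  defines "n \<equiv> real CARD('a) - 1"
  assumes "s = 2 * k" "k \<ge> 1"
  shows "real (hamming_weight (torus s) (cycle_word s a)) = n ^ s - n * real (fibre_count s a 1 0)"
proof -
  let ?Z = "{t \<in> torus s. (\<Sum>i\<in>{1..s}. a i * edge_values s t i) = 0}"
  have n: "real (CARD('a) - 1) = n"
    using real_card_units[where 'a = 'a] card_units[where 'a = 'a] by (simp add: n_def)
  have "hamming_weight (torus s) (cycle_word s a) = card (torus s - ?Z)"
    unfolding hamming_weight_def cycle_word_def by (intro arg_cong[where f = card]) auto
  also have "\<dots> = card (torus s :: (nat \<Rightarrow> 'a) set) - card ?Z"
    by (intro card_Diff_subset finite_subset[OF _ finite_torus]) auto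
  finally have "real (hamming_weight (torus s) (cycle_word s a))
      = real (card (torus s :: (nat \<Rightarrow> 'a) set)) - real (card ?Z)"
    by (simp add: of_nat_diff card_mono finite_torus)
  also have "card ?Z = (CARD('a) - 1) * fibre_count s a 1 0"
    unfolding fibre_count_def by (rule card_torus_edge_values[OF assms(2,3)])
  finally show ?thesis
    using n by (simp add: card_torus)
qed

text \<open>An index \<open>j\<close> outside the support is used to solve the relation between the edge values, after
  which the linear form lives on a product of \<open>s - 1\<close> copies of the units.\<close>

lemma hamming_weight_partial_support:
  fixes a :: "nat \<Rightarrow> 'a::{field,finite}"
  assumes "s = 2 * k" "k \<ge> 1" "card {i \<in> {1..s}. a i \<noteq> 0} < s"
  shows "real (hamming_weight (torus s) (cycle_word s a))
    = partial_weight CARD('a) s (card {i \<in> {1..s}. a i \<noteq> 0})"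
proof -
  let ?n = "real CARD('a) - 1"
  let ?r = "card {i \<in> {1..s}. a i \<noteq> 0}"
  have "{i \<in> {1..s}. a i \<noteq> 0} \<noteq> {1..s}"
    using assms(3) by (metis card_atLeastAtMost diff_Suc_1 less_irrefl)
  then obtain j where j: "j \<in> {1..s}" "a j = 0" by blast
  let ?I = "{1..s} - {j}"
  have drop: "(\<Sum>i\<in>{1..s}. a i * y i) = (\<Sum>i\<in>?I. a i * y i)" for y
    using j by (subst sum.remove[of _ j]) auto
  have "fibre_count s a 1 0 = card {y \<in> ?I \<rightarrow>\<^sub>E units. (\<Sum>i\<in>?I. a i * y i) = 0}"
    unfolding fibre_count_def drop torus_def
    by (rule card_alt_prod_fibre) (use j in auto)
  moreover have "{i \<in> ?I. a i \<noteq> 0} = {i \<in> {1..s}. a i \<noteq> 0}" using j by auto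
  moreover have "card ?I = s - 1" using j by simp
  ultimately have fib: "real CARD('a) * real (fibre_count s a 1 0)
      = ?n ^ (s - 1) + (-1) ^ ?r * ?n ^ (s - 1 - ?r + 1)"
    using card_linear_zeros[of ?I a] by simp
  have pw: "?n * ?n ^ (s - 1) = ?n ^ s" "?n * ?n ^ (s - 1 - ?r + 1) = ?n ^ (s - ?r + 1)"
  proof -
    have "Suc (s - 1) = s" "Suc (s - 1 - ?r + 1) = s - ?r + 1" using assms by auto
    then show "?n * ?n ^ (s - 1) = ?n ^ s" "?n * ?n ^ (s - 1 - ?r + 1) = ?n ^ (s - ?r + 1)"
      by (simp_all only: power_Suc[symmetric])
  qed
  have "real CARD('a) * real (hamming_weight (torus s) (cycle_word s a))
      = real CARD('a) * ?n ^ s - ?n * (real CARD('a) * real (fibre_count s a 1 0))"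
    unfolding hamming_weight_cycle_word[OF assms(1,2)] by (simp only: right_diff_distrib ac_simps)
  also have "\<dots> = real CARD('a) * ?n ^ s - (?n * ?n ^ (s - 1) + (-1) ^ ?r * (?n * ?n ^ (s - 1 - ?r + 1)))"
    unfolding fib by (simp only: distrib_left ac_simps)
  also have "\<dots> = ?n ^ (s + 1) - (-1) ^ ?r * ?n ^ (s - ?r + 1)"
    unfolding pw by (simp add: left_diff_distrib)
  finally show ?thesis
    unfolding partial_weight_def by (simp add: eq_divide_eq mult.commute)
qed

lemma hamming_weight_full_support:
  fixes a :: "nat \<Rightarrow> 'a::{field,finite}"
  assumes "s = 2 * k" "k \<ge> 1" "\<And>i. i \<in> {1..s} \<Longrightarrow> a i \<noteq> 0"
  shows "real (hamming_weight (torus s) (cycle_word s a))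
    = full_weight CARD('a) k (alt_prod {1..s} a = (-1) ^ k)"
proof -
  let ?q = "real CARD('a)" and ?n = "real CARD('a) - 1"
  let ?b = "alt_prod {1..s} a = (-1) ^ k"
  have fib: "?q * real (fibre_count s a 1 0)
      = ?n ^ (s - 1) + 1 - ?q ^ k + (if ?b then ?q ^ k * ?n else 0)"
    using fibre_count_zero[of k 1 a] assms by simp
  have pw: "?n * ?n ^ (s - 1) = ?n ^ s"
    using assms(1,2) by (simp flip: power_Suc)
  have "?q * real (hamming_weight (torus s) (cycle_word s a))
      = ?q * ?n ^ s - ?n * (?q * real (fibre_count s a 1 0))"
    unfolding hamming_weight_cycle_word[OF assms(1,2)] by (simp only: right_diff_distrib ac_simps)
  also have "\<dots> = ?q * ?n ^ s - (?n * ?n ^ (s - 1) + ?n - ?n * ?q ^ k + (if ?b then ?n\<^sup>2 * ?q ^ k else 0))"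
    unfolding fib by (simp add: algebra_simps power2_eq_square)
  also have "\<dots> = ?n ^ (s + 1) - ?n + ?n * ?q ^ k - (if ?b then ?n\<^sup>2 * ?q ^ k else 0)"
    unfolding pw by (simp add: algebra_simps)
  finally show ?thesis
    unfolding full_weight_def assms(1) by (simp add: eq_divide_eq mult.commute)
qed

text \<open>Zero is the value of \<open>partial_weight\<close> at \<open>r = 0\<close>, and no other weight takes this value. So it is
  the comparison of the weights that makes the coefficient vector of a word unique.\<close>

lemma hamming_weight_eq_0_iff:
  fixes a :: "nat \<Rightarrow> 'a::{field,finite}"
  assumes "CARD('a) > 2" "s = 2 * k" "k \<ge> 2"
  shows "hamming_weight (torus s) (cycle_word s a) = 0 \<longleftrightarrow> (\<forall>i\<in>{1..s}. a i = 0)"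
proof
  assume "\<forall>i\<in>{1..s}. a i = 0"
  then show "hamming_weight (torus s) (cycle_word s a) = 0"
    by (simp add: hamming_weight_def cycle_word_def)
next
  assume w: "hamming_weight (torus s) (cycle_word s a) = 0"
  let ?S = "{i \<in> {1..s}. a i \<noteq> 0}"
  have p0: "partial_weight CARD('a) s 0 = 0" by (simp add: partial_weight_def)
  have "card ?S \<le> card {1..s}" by (rule card_mono) auto
  then have "card ?S \<le> s" by simp
  have "card ?S < s"
  proof (rule ccontr)
    assume "\<not> card ?S < s"
    then have "?S = {1..s}" using \<open>card ?S \<le> s\<close> by (intro card_subset_eq) auto
    then have nz: "a i \<noteq> 0" if "i \<in> {1..s}" for i using that by blast
    have "k \<ge> 1" using assms(3) by simp
    then have "full_weight CARD('a) k (alt_prod {1..s} a = (-1) ^ k) = partial_weight CARD('a) s 0"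
      using hamming_weight_full_support[of s k a, OF assms(2) _ nz] w p0 by simp
    then show False
      using partial_neq_full_special[of "CARD('a)" k 0] partial_eq_full_generic[of "CARD('a)" k 0] assms
      by (cases "alt_prod {1..s} a = (-1) ^ k") auto
  qed
  then have "partial_weight CARD('a) s (card ?S) = partial_weight CARD('a) s 0"
    using hamming_weight_partial_support[of s k a] assms w p0 by simp
  then have "card ?S = 0"
    using partial_weight_inj[OF assms(1)] \<open>card ?S \<le> s\<close> by blast
  then show "\<forall>i\<in>{1..s}. a i = 0" by simp
qed

lemma cycle_word_inj:
  assumes "CARD('a::{field,finite}) > 2" "s = 2 * k" "k \<ge> 2"
  shows "inj_on (cycle_word s) ({1..s} \<rightarrow>\<^sub>E (UNIV :: 'a set))"
proof (rule inj_onI)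
  fix a b :: "nat \<Rightarrow> 'a"
  assume ab: "a \<in> {1..s} \<rightarrow>\<^sub>E UNIV" "b \<in> {1..s} \<rightarrow>\<^sub>E UNIV" "cycle_word s a = cycle_word s b"
  have "cycle_word s (\<lambda>i. a i - b i) P = 0" if "P \<in> torus s" for P
    using fun_cong[OF ab(3), of P] that
    by (simp add: cycle_word_def left_diff_distrib sum_subtractf)
  then have "hamming_weight (torus s) (cycle_word s (\<lambda>i. a i - b i)) = 0"
    unfolding hamming_weight_def card_eq_0_iff by blast
  then have "\<forall>i\<in>{1..s}. a i = b i"
    using hamming_weight_eq_0_iff[OF assms, of "\<lambda>i. a i - b i"] by simp
  then show "a = b" by (intro PiE_ext[OF ab(1,2)]) blast
qed

lemma weight_count_cycle:
  assumes "CARD('a::{field,finite}) > 2" "s = 2 * k" "k \<ge> 2"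
  shows "weight_count (torus s) (edge_code s (cycle_edges s) :: ((nat \<Rightarrow> 'a) \<Rightarrow> 'a) set) j
    = card {a \<in> {1..s} \<rightarrow>\<^sub>E (UNIV :: 'a set). hamming_weight (torus s) (cycle_word s a) = j}"
proof -
  have "{c \<in> edge_code s (cycle_edges s). hamming_weight (torus s) c = j}
      = cycle_word s ` {a \<in> {1..s} \<rightarrow>\<^sub>E (UNIV :: 'a set). hamming_weight (torus s) (cycle_word s a) = j}"
    using assms by (subst edge_code_cycle) auto
  moreover have "inj_on (cycle_word s)
      {a \<in> {1..s} \<rightarrow>\<^sub>E (UNIV :: 'a set). hamming_weight (torus s) (cycle_word s a) = j}"
    by (rule inj_on_subset[OF cycle_word_inj[OF assms]]) auto
  ultimately show ?thesis by (simp add: weight_count_def card_image)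
qed

lemma card_alt_prod_other:
  fixes c :: "'a::{field,finite}"
  assumes "s \<ge> 1" "c \<noteq> 0"
  shows "card {y \<in> torus s. alt_prod {1..s} y \<noteq> c} = (CARD('a) - 1) ^ s - (CARD('a) - 1) ^ (s - 1)"
proof -
  let ?H = "{y \<in> torus s. alt_prod {1..s} y = c}"
  have "card {y \<in> torus s. alt_prod {1..s} y \<noteq> c} = card (torus s - ?H)"
    by (intro arg_cong[where f = card]) auto
  also have "\<dots> = card (torus s :: (nat \<Rightarrow> 'a) set) - card ?H"
    by (intro card_Diff_subset finite_subset[OF _ finite_torus]) auto
  also have "card ?H = (CARD('a) - 1) ^ (s - 1)"
    using card_alt_prod[of "{1..s}" c] assms by (simp add: torus_def)
  finally show ?thesis by (simp add: card_torus)
qed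

section \<open>Weight distribution and minimum distance\<close>

lemma torus_eq_full_support:
  "{a \<in> {1..s} \<rightarrow>\<^sub>E UNIV. card {i \<in> {1..s}. a i \<noteq> 0} = s} = torus s"
proof -
  have "card {i \<in> {1..s}. a i \<noteq> 0} = s \<longleftrightarrow> (\<forall>i\<in>{1..s}. a i \<noteq> 0)" for a :: "nat \<Rightarrow> 'a"
  proof
    assume "card {i \<in> {1..s}. a i \<noteq> 0} = s"
    then have "{i \<in> {1..s}. a i \<noteq> 0} = {1..s}" by (intro card_subset_eq) auto
    then show "\<forall>i\<in>{1..s}. a i \<noteq> 0" by blast
  next
    assume "\<forall>i\<in>{1..s}. a i \<noteq> 0"
    then have "{i \<in> {1..s}. a i \<noteq> 0} = {1..s}" by blast
    then show "card {i \<in> {1..s}. a i \<noteq> 0} = s" by simp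
  qed
  then show ?thesis by (auto simp: torus_def PiE_def Pi_def)
qed

theorem theorem4p7:
  fixes q s k :: nat
    and T :: "(nat \<Rightarrow> 'a::{field,finite}) set"
    and C :: "((nat \<Rightarrow> 'a) \<Rightarrow> 'a) set"
    and A :: "nat \<Rightarrow> nat"
  assumes q: "q = CARD('a)" "q > 2"
    and s: "s = 2 * k" "s \<ge> 4"
  defines "T \<equiv> torus s"
    and "C \<equiv> edge_code s (cycle_edges s)"
    and "A \<equiv> weight_count T C"
  shows
    "(\<exists>(w :: nat \<Rightarrow> nat) (wa :: nat) (wb :: nat).
        (\<forall>r\<in>{1..s - 1}. real (w r) = (\<Sum>i<r. (-1) ^ i * (real q - 1) ^ (s - i))) \<and>
        real wa = (real q - 1) ^ s
          - real q ^ (k - 2) * ((real q - 1) ^ 3 + (real q - 1) ^ 2 * (real q - 2))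
          - ((real q - 1) ^ s - (real q - 1) * (real q ^ (k - 2) - 1)
               - real q ^ (k - 2) * (real q - 1) ^ 4) / real q \<and>
        real wb = (real q - 1) ^ s
          - real q ^ (k - 2) * (real q - 1) ^ 2 * (real q - 3)
          - ((real q - 1) ^ s - (real q - 1) * (real q ^ (k - 2) - 1)
               - real q ^ (k - 2) * (real q - 1) ^ 4) / real q \<and>
        (\<forall>r\<in>{1..s - 1}. \<not> (q = 3 \<and> s = 4 \<and> r = 1) \<longrightarrow>
           A (w r) = (s choose r) * (q - 1) ^ r) \<and>
        A wa = (q - 1) ^ (s - 1) \<and>
        (\<not> (q = 3 \<and> s = 4) \<longrightarrow> A wb = (q - 1) ^ s - (q - 1) ^ (s - 1)) \<and>
        \<comment> \<open>For \<open>q = 3\<close>, \<open>s = 4\<close>, and only then, two of the listed weights coincide, and the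
            two values given for that weight add up.\<close>
        (q = 3 \<and> s = 4 \<longrightarrow> w 1 = wb \<and>
           A wb = (s choose 1) * (q - 1) ^ 1 + ((q - 1) ^ s - (q - 1) ^ (s - 1))) \<and>
        (\<forall>j\<in>{1..card T}. j \<notin> w ` {1..s - 1} \<union> {wa, wb} \<longrightarrow> A j = 0)) \<and>
     real (min_distance T C) =
       (if real q ^ k * (real q - 2) + 1 \<ge> (real q - 1) ^ (2 * k - 2)
        then (real q - 1) ^ s
          - real q ^ (k - 2) * ((real q - 1) ^ 3 + (real q - 1) ^ 2 * (real q - 2))
          - ((real q - 1) ^ s - (real q - 1) * (real q ^ (k - 2) - 1)) / real q
          + real q powi (int k - 3) * (real q - 1) ^ 4
        else (real q - 1) ^ (s - 1) * (real q - 2))"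
proof -
  define V :: "(nat \<Rightarrow> 'a) set" where "V = {1..s} \<rightarrow>\<^sub>E UNIV"
  define supp where "supp a = card {i \<in> {1..s}. a i \<noteq> 0}" for a :: "nat \<Rightarrow> 'a"
  define special where "special a \<longleftrightarrow> alt_prod {1..s} a = (-1) ^ k" for a :: "nat \<Rightarrow> 'a"
  define wt where "wt a = hamming_weight T (cycle_word s a)" for a :: "nat \<Rightarrow> 'a"
  define w where "w r = nat \<lfloor>partial_weight q s r\<rfloor>" for r
  define wa where "wa = nat \<lfloor>full_weight q k True\<rfloor>"
  define wb where "wb = nat \<lfloor>full_weight q k False\<rfloor>"
  have k: "k \<ge> 2" using s by simp
  have q3: "CARD('a) > 2" using q by simp
  have finV: "finite V" unfolding V_def by (intro finite_PiE) auto
  have supp_le: "supp a \<le> s" for a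
  proof -
    have "supp a \<le> card {1..s}" unfolding supp_def by (rule card_mono) auto
    then show ?thesis by simp
  qed
  have full: "{a \<in> V. supp a = s} = T"
    unfolding V_def supp_def T_def by (rule torus_eq_full_support)
  have wt_part: "real (wt a) = partial_weight q s (supp a)" if "supp a < s" for a
    using hamming_weight_partial_support[of s k a] that s k q
    by (simp add: wt_def supp_def T_def)
  have wt_full: "real (wt a) = full_weight q k (special a)" if "a \<in> T" for a
  proof -
    have "a i \<noteq> 0" if "i \<in> {1..s}" for i
      using \<open>a \<in> T\<close> that by (auto simp: T_def torus_def PiE_def Pi_def)
    then show ?thesis
      using hamming_weight_full_support[of s k a] s k q
      by (simp add: wt_def special_def T_def)
  qed
  have A: "A j = card {a \<in> V. wt a = j}" for j
    using weight_count_cycle[OF q3 s(1) k, of j] by (simp add: A_def T_def C_def V_def wt_def)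
  have card_supp: "card {a \<in> V. supp a = r} = (s choose r) * (q - 1) ^ r" for r
    using card_support_eq[of "{1..s}" r] q by (simp add: V_def supp_def)
  have card_special: "card {a \<in> T. special a} = (q - 1) ^ (s - 1)"
    using card_alt_prod[of "{1..s}" "(-1) ^ k :: 'a"] s q by (simp add: T_def torus_def special_def)
  have card_generic: "card {a \<in> T. \<not> special a} = (q - 1) ^ s - (q - 1) ^ (s - 1)"
    using card_alt_prod_other[of s "(-1) ^ k :: 'a"] s q by (simp add: T_def special_def)
  have ex_supp: "\<exists>a\<in>V. supp a = r" if "r \<le> s" for r
  proof -
    have "0 < (s choose r) * (q - 1) ^ r" using that q by simp
    then have "{a \<in> V. supp a = r} \<noteq> {}" using card_supp[of r] by (metis card.empty less_irrefl)
    then show ?thesis by blast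
  qed
  have ex_special: "\<exists>a\<in>T. special a"
  proof -
    have "0 < (q - 1) ^ (s - 1)" using q by simp
    then have "{a \<in> T. special a} \<noteq> {}" using card_special by (metis card.empty less_irrefl)
    then show ?thesis by blast
  qed
  have ex_generic: "\<exists>a\<in>T. \<not> special a"
  proof -
    have "(q - 1) ^ (s - 1) < (q - 1) ^ s" using q s by (intro power_strict_increasing) auto
    then have "{a \<in> T. \<not> special a} \<noteq> {}"
      using card_generic by (metis card.empty less_irrefl zero_less_diff)
    then show ?thesis by blast
  qed
  have T_sub: "T \<subseteq> V" and T_supp: "a \<in> T \<Longrightarrow> supp a = s" for a using full by auto
  \<comment> \<open>Each closed form is the weight of some word and hence a natural number, which the floor recovers.\<close>
  have w: "real (w r) = partial_weight q s r" if r: "r < s" for r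
  proof -
    obtain a where "a \<in> V" "supp a = r" using ex_supp[OF less_imp_le[OF r]] by blast
    then have "partial_weight q s r = real (wt a)" using wt_part[of a] r by simp
    then show ?thesis by (simp add: w_def)
  qed
  have wa: "real wa = full_weight q k True"
  proof -
    obtain a where "a \<in> T" "special a" using ex_special by blast
    then have "full_weight q k True = real (wt a)" using wt_full[of a] by simp
    then show ?thesis by (simp add: wa_def)
  qed
  have wb: "real wb = full_weight q k False"
  proof -
    obtain a where "a \<in> T" "\<not> special a" using ex_generic by blast
    then have "full_weight q k False = real (wt a)" using wt_full[of a] by simp
    then show ?thesis by (simp add: wb_def)
  qed
  have w_inj: "w r = w r' \<longleftrightarrow> r = r'" if "r < s" "r' < s" for r r'
    using partial_weight_inj[OF q(2), of r s r'] w that by (metis less_imp_le)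
  have wa_neq: "w r \<noteq> wa" if "r < s" for r
    using partial_neq_full_special[OF q(2) k, of r] w[OF that] wa that s(1) by metis
  have wb_eq: "w r = wb \<longleftrightarrow> q = 3 \<and> s = 4 \<and> r = 1" if "r < s" for r
  proof
    assume "w r = wb"
    then have "partial_weight q (2 * k) r = full_weight q k False"
      using w[OF that] wb s(1) by simp
    then show "q = 3 \<and> s = 4 \<and> r = 1"
      using partial_eq_full_generic[OF q(2) k, of r] that s(1) by simp
  next
    assume r: "q = 3 \<and> s = 4 \<and> r = 1"
    then have "k = 2" using s(1) by simp
    then have "real (w r) = real wb"
      using w[OF that] wb r by (simp add: partial_weight_def full_weight_def)
    then show "w r = wb" by simp
  qed
  have wab: "wa \<noteq> wb" using full_weight_inj[OF q(2), of k True False] wa wb by auto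
  have wt_cases: "wt a = (if supp a < s then w (supp a) else if special a then wa else wb)"
    if "a \<in> V" for a
  proof (cases "supp a < s")
    case True
    then have "real (wt a) = real (w (supp a))" using wt_part[OF True] w[OF True] by simp
    then show ?thesis using True by simp
  next
    case False
    then have "a \<in> T" using that full supp_le[of a] by auto
    then have "real (wt a) = real (if special a then wa else wb)" using wt_full[of a] wa wb by simp
    then show ?thesis using False by simp
  qed
  have class_w: "{a \<in> V. wt a = w r} = {a \<in> V. supp a = r}"
    if "r < s" "\<not> (q = 3 \<and> s = 4 \<and> r = 1)" for r
  proof (intro Collect_cong conj_cong refl)
    fix a assume "a \<in> V"
    show "wt a = w r \<longleftrightarrow> supp a = r"
      unfolding wt_cases[OF \<open>a \<in> V\<close>]
      using w_inj[of "supp a" r] wa_neq[of r] wb_eq[of r] that by (auto dest: sym)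
  qed
  have class_wa: "{a \<in> V. wt a = wa} = {a \<in> T. special a}"
  proof (intro set_eqI iffI)
    fix a assume "a \<in> {a \<in> V. wt a = wa}"
    then have "a \<in> V" "wt a = wa" by auto
    then have "\<not> supp a < s" "special a"
      using wt_cases[of a] wa_neq[of "supp a"] wab by (auto split: if_splits)
    then show "a \<in> {a \<in> T. special a}" using \<open>a \<in> V\<close> full supp_le[of a] by auto
  next
    fix a assume "a \<in> {a \<in> T. special a}"
    then show "a \<in> {a \<in> V. wt a = wa}" using T_sub T_supp[of a] wt_cases[of a] by auto
  qed
  have class_wb: "{a \<in> V. wt a = wb}
      = {a \<in> T. \<not> special a} \<union> {a \<in> V. q = 3 \<and> s = 4 \<and> supp a = 1}"
  proof (intro set_eqI iffI)
    fix a assume "a \<in> {a \<in> V. wt a = wb}"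
    then have a: "a \<in> V" "wt a = wb" by auto
    show "a \<in> {a \<in> T. \<not> special a} \<union> {a \<in> V. q = 3 \<and> s = 4 \<and> supp a = 1}"
    proof (cases "supp a < s")
      case True
      then have "w (supp a) = wb" using wt_cases[OF a(1)] a(2) by simp
      then show ?thesis using wb_eq[OF True] a(1) by blast
    next
      case False
      then have "a \<in> T" using a(1) full supp_le[of a] by auto
      moreover have "\<not> special a" using wt_cases[OF a(1)] a(2) False wab by auto
      ultimately show ?thesis by blast
    qed
  next
    fix a assume "a \<in> {a \<in> T. \<not> special a} \<union> {a \<in> V. q = 3 \<and> s = 4 \<and> supp a = 1}"
    then show "a \<in> {a \<in> V. wt a = wb}"
    proof
      assume "a \<in> {a \<in> T. \<not> special a}"
      then show ?thesis using T_sub T_supp[of a] wt_cases[of a] by auto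
    next
      assume "a \<in> {a \<in> V. q = 3 \<and> s = 4 \<and> supp a = 1}"
      then show ?thesis using wt_cases[of a] wb_eq[of 1] by auto
    qed
  qed
  have A_w: "A (w r) = (s choose r) * (q - 1) ^ r"
    if "r < s" "\<not> (q = 3 \<and> s = 4 \<and> r = 1)" for r
    unfolding A class_w[OF that] by (rule card_supp)
  have A_wa: "A wa = (q - 1) ^ (s - 1)"
    unfolding A class_wa by (rule card_special)
  have A_wb: "A wb = (q - 1) ^ s - (q - 1) ^ (s - 1)" if "\<not> (q = 3 \<and> s = 4)"
  proof -
    have "{a \<in> V. q = 3 \<and> s = 4 \<and> supp a = 1} = {}" using that by blast
    then show ?thesis by (simp only: A class_wb card_generic Un_empty_right)
  qed
  have A_wb': "A wb = (s choose 1) * (q - 1) ^ 1 + ((q - 1) ^ s - (q - 1) ^ (s - 1))"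
    if "q = 3 \<and> s = 4"
  proof -
    have "{a \<in> V. q = 3 \<and> s = 4 \<and> supp a = 1} = {a \<in> V. supp a = 1}" using that by blast
    then have "A wb = card ({a \<in> T. \<not> special a} \<union> {a \<in> V. supp a = 1})"
      unfolding A class_wb by (simp only:)
    also have "\<dots> = card {a \<in> T. \<not> special a} + card {a \<in> V. supp a = 1}"
    proof (rule card_Un_disjoint)
      show "finite {a \<in> T. \<not> special a}" using finite_subset[OF T_sub finV] by simp
      show "finite {a \<in> V. supp a = 1}" using finV by simp
      show "{a \<in> T. \<not> special a} \<inter> {a \<in> V. supp a = 1} = {}" using T_supp that by fastforce
    qed
    finally show ?thesis by (simp only: card_generic card_supp add.commute)
  qed
  have w0: "w 0 = 0" by (simp add: w_def partial_weight_def)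
  have weights: "j \<in> w ` {1..s - 1} \<union> {wa, wb}" if "j \<ge> 1" "A j \<noteq> 0" for j
  proof -
    have "{a \<in> V. wt a = j} \<noteq> {}" using that(2) A[of j] by (metis card.empty)
    then obtain a where a: "a \<in> V" "wt a = j" by blast
    show ?thesis
    proof (cases "supp a < s")
      case True
      then have j: "j = w (supp a)" using wt_cases[OF a(1)] a(2) by simp
      then have "supp a \<noteq> 0" using that(1) w0 by (metis not_one_le_zero)
      then show ?thesis using j True by auto
    next
      case False
      then show ?thesis using wt_cases[OF a(1)] a(2) by auto
    qed
  qed
  \<comment> \<open>The weights are at least \<open>w 2\<close>, except possibly \<open>wa\<close>; the condition decides which of the two is smaller.\<close>
  define D where "D = (if (real q - 1) ^ (2 * k - 2) \<le> real q ^ k * (real q - 2) + 1 then wa else w 2)"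
  have D_le: "D \<le> w 2" "D \<le> wa"
    using full_weight_ge(3)[OF q(2), of k] w[of 2] wa s k by (auto simp: D_def)
  have min: "min_distance T C = D"
    unfolding min_distance_def A_def[symmetric]
  proof (rule Least_equality)
    have "A D \<noteq> 0"
      using A_wa A_w[of 2] q s by (auto simp: D_def)
    then have "{a \<in> V. wt a = D} \<noteq> {}" using A[of D] by (metis card.empty)
    then obtain a where a: "a \<in> V" "wt a = D" by blast
    have "D \<le> card T"
      unfolding a(2)[symmetric] wt_def hamming_weight_def
      by (rule card_mono) (auto simp: T_def finite_torus)
    moreover have "D \<noteq> 0"
      using w0 wa_neq[of 0] w_inj[of 2 0] s by (auto simp: D_def)
    ultimately show "D \<in> {1..card T} \<and> A D \<noteq> 0" using \<open>A D \<noteq> 0\<close> by simp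
  next
    fix j assume j: "j \<in> {1..card T} \<and> A j \<noteq> 0"
    then consider r where "r \<in> {1..s - 1}" "j = w r" | "j = wa" | "j = wb"
      using weights[of j] by auto
    then show "D \<le> j"
    proof cases
      case (1 r)
      then have "1 \<le> r" "r < s" by auto
      then have "real (w 2) \<le> real (w r)"
        using partial_weight_ge[OF q(2), of r s] w[of 2] w[of r] s by simp
      then show ?thesis using D_le(1) 1(2) by simp
    next
      case 2
      then show ?thesis using D_le(2) by simp
    next
      case 3
      have "real wa \<le> real wb" using full_weight_ge(2)[OF q(2), of k] wa wb k by simp
      then show ?thesis using D_le(2) 3 by simp
    qed
  qed
  show ?thesis
  proof (rule conjI, rule exI[of _ w], rule exI[of _ wa], rule exI[of _ wb], (intro conjI)?)
    show "\<forall>r\<in>{1..s - 1}. real (w r) = (\<Sum>i<r. (-1) ^ i * (real q - 1) ^ (s - i))"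
      using w partial_weight_eq_sum[of q _ s] q(2) by auto
    show "real wa = (real q - 1) ^ s
          - real q ^ (k - 2) * ((real q - 1) ^ 3 + (real q - 1) ^ 2 * (real q - 2))
          - ((real q - 1) ^ s - (real q - 1) * (real q ^ (k - 2) - 1)
               - real q ^ (k - 2) * (real q - 1) ^ 4) / real q"
      unfolding wa s(1) by (rule full_weight_True_eq[OF q(2) k])
    show "real wb = (real q - 1) ^ s
          - real q ^ (k - 2) * (real q - 1) ^ 2 * (real q - 3)
          - ((real q - 1) ^ s - (real q - 1) * (real q ^ (k - 2) - 1)
               - real q ^ (k - 2) * (real q - 1) ^ 4) / real q"
      unfolding wb s(1) by (rule full_weight_False_eq[OF q(2) k])
    show "\<forall>r\<in>{1..s - 1}. \<not> (q = 3 \<and> s = 4 \<and> r = 1) \<longrightarrow> A (w r) = (s choose r) * (q - 1) ^ r"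
    proof (intro ballI impI)
      fix r assume "r \<in> {1..s - 1}" "\<not> (q = 3 \<and> s = 4 \<and> r = 1)"
      moreover from this have "r < s" by auto
      ultimately show "A (w r) = (s choose r) * (q - 1) ^ r" by (intro A_w)
    qed
    show "A wa = (q - 1) ^ (s - 1)" by (rule A_wa)
    show "\<not> (q = 3 \<and> s = 4) \<longrightarrow> A wb = (q - 1) ^ s - (q - 1) ^ (s - 1)"
      using A_wb by blast
    show "q = 3 \<and> s = 4 \<longrightarrow> w 1 = wb \<and>
        A wb = (s choose 1) * (q - 1) ^ 1 + ((q - 1) ^ s - (q - 1) ^ (s - 1))"
    proof
      assume "q = 3 \<and> s = 4"
      then show "w 1 = wb \<and> A wb = (s choose 1) * (q - 1) ^ 1 + ((q - 1) ^ s - (q - 1) ^ (s - 1))"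
        using wb_eq[of 1] A_wb' by simp
    qed
    show "\<forall>j\<in>{1..card T}. j \<notin> w ` {1..s - 1} \<union> {wa, wb} \<longrightarrow> A j = 0"
      using weights by (meson atLeastAtMost_iff)
    have "real D = (if (real q - 1) ^ (2 * k - 2) \<le> real q ^ k * (real q - 2) + 1
        then full_weight q k True else partial_weight q s 2)"
      using wa w[of 2] s by (simp add: D_def)
    then show "real (min_distance T C) =
       (if real q ^ k * (real q - 2) + 1 \<ge> (real q - 1) ^ (2 * k - 2)
        then (real q - 1) ^ s
          - real q ^ (k - 2) * ((real q - 1) ^ 3 + (real q - 1) ^ 2 * (real q - 2))
          - ((real q - 1) ^ s - (real q - 1) * (real q ^ (k - 2) - 1)) / real q
          + real q powi (int k - 3) * (real q - 1) ^ 4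
        else (real q - 1) ^ (s - 1) * (real q - 2))"
      unfolding min full_weight_True_eq_powi[OF q(2) k, folded s(1)]
      using partial_weight_2[of q s] q s by simp
  qed
qed

end
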